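(* Suppose that at least one of the following two conditions holds: (a) for almost all $u\in(0,1)$, $f(X_{N(1)},u)\to f(X_1,u)$ in probability as $n\to\infty$; (b) for all $k=1,\ldots,K$, the mapping $x\mapsto Q_k(x)$ is $P_X$-almost everywhere continuous. Assume moreover that there is a sequence $(k_n)$ such that $$\sum_{n\ge1}P(L_n\ge k_n)<\infty,\qquad k_nP(L_n\ge k_n)\to0\qquad\text{and}\qquad k_n=o\big(\sqrt{n/\log n}\big).$$ Then the estimator $\widehat\psi(X,Y)$ is strongly consistent, i.e. $\widehat\psi(X,Y)\to\psi(X,Y)$ almost surely as $n\to\infty$.
   Context: $(\mathcal{H},d)$ is a separable metric space, $X$ is an $\mathcal{H}$-valued random variable with law $P_X$, and $Y$ is categorical with levels $\{1,\ldots,K\}$, $K\ge2$, $p_k=P(Y=k)>0$ for all $k$. $Q_k(x)=P(Y=k\mid X=x)$ and $f(x,u)=\min\{k\in\{1,\ldots,K\}:\sum_{j=1}^kQ_j(x)>u\}$. With $U,U'$ uniform on $(0,1)$ and $X,U,U'$ independent, one assumes (without changing the law of $(X,Y)$) $Y=f(X,U)$ and sets $Y'=f(X,U')$. With $p_{i,j}=P(Y=i,Y'=j)$, $$\psi(X,Y)=\frac1{K-1}\sum_{i,j=1}^K\frac{(p_{i,j}-p_ip_j)^2}{p_ip_j}.$$ Sample: $(X_i,U_i)$, $i\ge 1$, are i.i.d. copies of $(X,U)$ and $Y_i=f(X_i,U_i)$. $N(i)=N_n(i)\in\{1,\ldots,n\}\setminus\{i\}$ is the index of the nearest neighbour of $X_i$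 among the other covariates $X_j$, $1\le j\le n$, $j\ne i$, with respect to $d$. It is assumed that $d(X_1,X_2)$ has a continuous distribution, so that nearest neighbours are almost surely unique. $L_n=\max_{1\le i\le n}\#\{j\le n: N(j)=i\}$ is the maximal in-degree of the nearest neighbour graph of $X_1,\ldots,X_n$. Set $$\widehat p_{k,l}=\frac1n\sum_{i=1}^n1\{Y_i=k,Y_{N(i)}=l\},\quad \widehat p_k=\sum_{l=1}^K\widehat p_{k,l},\quad \widehat q_l=\sum_{k=1}^K\widehat p_{k,l},$$ $$\widehat\psi(X,Y)=\frac{1}{K-1}\sum_{k,l=1}^K\frac{(\widehat p_{k,l}-\widehat p_k\widehat q_l)^2}{\widehat p_k\widehat q_l},$$ where summands with zero denominator are set to $0$. *)

theory Defs
  imports "HOL-Probability.Probability" "HOL-Library.Landau_Symbols"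
begin

text \<open>Mutual independence of three random variables with possibly different target types
  (the library's \<^term>\<open>prob_space.indep_vars\<close> needs a common target type).\<close>

definition (in prob_space) indep_var3 ::
  "'b measure \<Rightarrow> ('a \<Rightarrow> 'b) \<Rightarrow> 'c measure \<Rightarrow> ('a \<Rightarrow> 'c) \<Rightarrow> 'd measure \<Rightarrow> ('a \<Rightarrow> 'd) \<Rightarrow> bool" where
  "indep_var3 MA A MB B MC C \<longleftrightarrow>
     random_variable MA A \<and> random_variable MB B \<and> random_variable MC C \<and>
     indep_sets (\<lambda>i::nat.
       if i = 0 then {A -` S \<inter> space M | S. S \<in> sets MA}
       else if i = 1 then {B -` S \<inter> space M | S. S \<in> sets MB}
       else {C -` S \<inter> space M | S. S \<in> sets MC}) {0, 1, 2}"

definition tendsto_in_prob ::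
  "'w measure \<Rightarrow> (nat \<Rightarrow> 'w \<Rightarrow> 'b::metric_space) \<Rightarrow> ('w \<Rightarrow> 'b) \<Rightarrow> bool" where
  "tendsto_in_prob M Z Z0 \<longleftrightarrow>
     (\<forall>\<epsilon>>0. (\<lambda>n. \<P>(\<omega> in M. dist (Z n \<omega>) (Z0 \<omega>) > \<epsilon>)) \<longlonglongrightarrow> 0)"

text \<open>\<open>q\<close> is a version of \<open>x \<mapsto> P(Y = k | X = x)\<close>, i.e. \<open>q(X)\<close> is a version of the
  conditional expectation of the indicator of \<open>Y = k\<close> given the sigma-algebra generated by \<open>X\<close>.\<close>

definition cond_prob_version ::
  "'w measure \<Rightarrow> ('w \<Rightarrow> 'a::topological_space) \<Rightarrow> ('w \<Rightarrow> nat) \<Rightarrow> nat \<Rightarrow> ('a \<Rightarrow> real) \<Rightarrow> bool" where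
  "cond_prob_version M X Y k q \<longleftrightarrow>
     q \<in> borel_measurable borel \<and>
     (AE \<omega> in M. q (X \<omega>) =
        real_cond_exp M (vimage_algebra (space M) X borel)
          (indicator {\<omega> \<in> space M. Y \<omega> = k}) \<omega>)"

text \<open>For \<open>0 < u < 1\<close> and \<open>Q 1 x, \<dots>, Q K x\<close> a probability vector (which versions of the
  conditional probabilities are for almost every \<open>x\<close>) the minimum is over a nonempty set;
  otherwise the value is irrelevant.\<close>

definition level_fun :: "nat \<Rightarrow> (nat \<Rightarrow> 'a \<Rightarrow> real) \<Rightarrow> 'a \<Rightarrow> real \<Rightarrow> nat" where
  "level_fun K Q x u = Min {k \<in> {1..K}. (\<Sum>j=1..k. Q j x) > u}"

definition psi :: "'w measure \<Rightarrow> nat \<Rightarrow> ('w \<Rightarrow> nat) \<Rightarrow> ('w \<Rightarrow> nat) \<Rightarrow> real" where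
  "psi M K Y Y' = 1 / (real K - 1) * (\<Sum>i=1..K. \<Sum>j=1..K.
     (\<P>(\<omega> in M. Y \<omega> = i \<and> Y' \<omega> = j) - \<P>(\<omega> in M. Y \<omega> = i) * \<P>(\<omega> in M. Y \<omega> = j))\<^sup>2 /
     (\<P>(\<omega> in M. Y \<omega> = i) * \<P>(\<omega> in M. Y \<omega> = j)))"

text \<open>Index of the nearest neighbour of \<open>x i\<close> among the other points of \<open>x 1, \<dots>, x n\<close>.
  Ties are resolved by the smallest index, which makes the neighbour index of a random sample a
  random variable.  The value is meaningful only for \<open>n \<ge> 2\<close>.\<close>

definition nn_index :: "nat \<Rightarrow> (nat \<Rightarrow> 'a::metric_space) \<Rightarrow> nat \<Rightarrow> nat" where
  "nn_index n x i = (LEAST j. j \<in> {1..n} - {i} \<and>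
     (\<forall>l \<in> {1..n} - {i}. dist (x i) (x j) \<le> dist (x i) (x l)))"

definition max_indegree :: "nat \<Rightarrow> (nat \<Rightarrow> 'a::metric_space) \<Rightarrow> nat" where
  "max_indegree n x = Max ((\<lambda>i. card {j \<in> {1..n}. nn_index n x j = i}) ` {1..n})"

text \<open>In the estimators, \<open>y\<close> are the observed levels and \<open>N\<close> is the nearest neighbour map.\<close>

definition p2_hat :: "nat \<Rightarrow> (nat \<Rightarrow> nat) \<Rightarrow> (nat \<Rightarrow> nat) \<Rightarrow> nat \<Rightarrow> nat \<Rightarrow> real" where
  "p2_hat n y N k l = 1 / real n * (\<Sum>i=1..n. of_bool (y i = k \<and> y (N i) = l))"

definition p_hat :: "nat \<Rightarrow> nat \<Rightarrow> (nat \<Rightarrow> nat) \<Rightarrow> (nat \<Rightarrow> nat) \<Rightarrow> nat \<Rightarrow> real" where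
  "p_hat K n y N k = (\<Sum>l=1..K. p2_hat n y N k l)"

definition q_hat :: "nat \<Rightarrow> nat \<Rightarrow> (nat \<Rightarrow> nat) \<Rightarrow> (nat \<Rightarrow> nat) \<Rightarrow> nat \<Rightarrow> real" where
  "q_hat K n y N l = (\<Sum>k=1..K. p2_hat n y N k l)"

text \<open>Summands with zero denominator vanish because \<open>a / 0 = 0\<close> in HOL.\<close>

definition psi_hat :: "nat \<Rightarrow> nat \<Rightarrow> (nat \<Rightarrow> nat) \<Rightarrow> (nat \<Rightarrow> nat) \<Rightarrow> real" where
  "psi_hat K n y N = 1 / (real K - 1) * (\<Sum>k=1..K. \<Sum>l=1..K.
     (p2_hat n y N k l - p_hat K n y N k * q_hat K n y N l)\<^sup>2 /
     (p_hat K n y N k * q_hat K n y N l))"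

end

theory Submission
  imports Defs "HOL-Real_Asymp.Real_Asymp"
begin

text \<open>Fluctuations: if \<open>L\<^sub>n\<close> is below \<open>k\<^sub>n\<close> for two samples, the estimates of \<open>p\<^sub>k\<^sub>l\<close> differ by at most
  \<open>(1 + 2 k\<^sub>n) / n\<close> times the number of observations in which the samples differ.  Two measurable
  sets of samples at Hamming distance at least \<open>t\<close> satisfy \<open>P(A) P(B) \<le> exp (- t\<^sup>2 / n)\<close>; taking for \<open>B\<close> the samples
  with a large deviation and for \<open>A\<close> those with a small one, whose probability Markov's
  inequality bounds from below, makes the deviations from the mean summable.  The event
  \<open>L\<^sub>n \<ge> k\<^sub>n\<close> is simply excluded, so that no measurable Lipschitz extension is needed.

  Means: by exchangeability the mean of the estimate is \<open>P(Y\<^sub>1 = k, Y\<^sub>N\<^sub>(\<^sub>1\<^sub>) = l)\<close>, and averaging over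
  the independent labels gives \<open>E (R\<^sub>k(X\<^sub>1) R\<^sub>l(X\<^sub>N\<^sub>(\<^sub>1\<^sub>)))\<close>, where \<open>R\<^sub>l(x)\<close> is the measure of
  \<open>{u. f(x, u) = l}\<close>.  It differs from
  \<open>p\<^sub>k\<^sub>l = E (R\<^sub>k(X\<^sub>1) R\<^sub>l(X\<^sub>1))\<close> by at most the probability that \<open>f(X\<^sub>N\<^sub>(\<^sub>1\<^sub>), u)\<close> and \<open>f(X\<^sub>1, u)\<close>
  disagree, averaged over \<open>u\<close>.  This tends to \<open>0\<close> under (a) by dominated convergence, and under (b) because
  \<open>X\<^sub>N\<^sub>(\<^sub>1\<^sub>) \<rightarrow> X\<^sub>1\<close> almost surely and \<open>f(\<cdot>, u)\<close> is constant near \<open>x\<close> unless \<open>u\<close> is one of the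
  finitely many partial sums of the \<open>Q\<^sub>j(x)\<close>.\<close>

section \<open>A blow-up inequality for product measures\<close>

text \<open>A reverse Jensen inequality. With \<open>m\<close> the supremum of
  \<open>\<phi>\<close>, the function \<open>v = max \<phi> (m exp (-r))\<close> varies by a factor
  of at most \<open>exp r\<close> and satisfies \<open>v \<eta> \<le> E\<close>, so the product of
  the two means is at most \<open>E\<close> times the product of the means of \<open>v\<close> and
  \<open>1/v\<close>. The chord bound for \<open>1/v\<close> makes the latter at most cosh(r/2)^2,
  hence at most exp(r^2/4).\<close>

lemma one_point_functional_inequality:
  fixes \<phi> \<eta> :: "'a \<Rightarrow> real"
  assumes N: "prob_space N" and [measurable]: "\<phi> \<in> borel_measurable N" "\<eta> \<in> borel_measurable N"
    and \<phi>0: "\<And>s. s \<in> space N \<Longrightarrow> 0 \<le> \<phi> s" and \<phi>C: "\<And>s. s \<in> space N \<Longrightarrow> \<phi> s \<le> C"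
    and \<eta>0: "\<And>s. s \<in> space N \<Longrightarrow> 0 \<le> \<eta> s" and \<eta>C: "\<And>s. s \<in> space N \<Longrightarrow> \<eta> s \<le> C"
    and E: "0 \<le> E" and r: "0 \<le> r"
    and same: "\<And>s. s \<in> space N \<Longrightarrow> \<phi> s * \<eta> s \<le> E"
    and diff: "\<And>s t. s \<in> space N \<Longrightarrow> t \<in> space N \<Longrightarrow> \<phi> s * \<eta> t \<le> E * exp r"
  shows "(\<integral>s. \<phi> s \<partial>N) * (\<integral>s. \<eta> s \<partial>N) \<le> E * exp (r\<^sup>2 / 4)"
proof -
  interpret N: prob_space N by fact
  have int_bdd: "integrable N g" if "g \<in> borel_measurable N" "\<And>s. s \<in> space N \<Longrightarrow> 0 \<le> g s"
     "\<And>s. s \<in> space N \<Longrightarrow> g s \<le> C'" for g :: "'a \<Rightarrow> real" and C'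
    using that by (intro N.integrable_const_bound[where B=C']) auto
  have int: "integrable N \<phi>" "integrable N \<eta>"
    by (rule int_bdd[OF _ \<phi>0 \<phi>C] int_bdd[OF _ \<eta>0 \<eta>C]; simp)+
  define m where "m = (SUP s\<in>space N. \<phi> s)"
  have bdd: "bdd_above (\<phi> ` space N)" using \<phi>C by (auto intro!: bdd_aboveI)
  have \<phi>m: "\<phi> s \<le> m" if "s \<in> space N" for s
    unfolding m_def using bdd that by (rule cSUP_upper2) auto
  have m0: "0 \<le> m" using N.not_empty \<phi>m \<phi>0 by (metis all_not_in_conv order_trans)
  show ?thesis
  proof (cases "m = 0")
    case True
    then have "(\<integral>s. \<phi> s \<partial>N) = (\<integral>s. 0 \<partial>N)"
      using \<phi>m \<phi>0 by (intro Bochner_Integration.integral_cong) (auto intro: antisym)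
    then show ?thesis using E by simp
  next
    case False
    with m0 have m: "m > 0" by simp
    \<comment> \<open>The supremum \<open>m\<close> need not be attained, so \<open>diff\<close> is
      divided by \<open>\<eta> t\<close> before passing to the supremum; where
      \<open>\<eta> t\<close> vanishes the bound is trivial.\<close>
    have m\<eta>: "m * \<eta> t \<le> E * exp r" if t: "t \<in> space N" for t
    proof (cases "\<eta> t = 0")
      case True then show ?thesis using E by simp
    next
      case False
      with \<eta>0[OF t] have p: "\<eta> t > 0" by simp
      have "m \<le> E * exp r / \<eta> t"
        unfolding m_def using diff[OF _ t] p N.not_empty by (intro cSUP_least) (auto simp: field_simps)
      then show ?thesis using p by (simp add: field_simps)
    qed
    \<comment> \<open>The cut-off is chosen so that \<open>a * \<eta> s \<le> E\<close> still
      follows from \<open>m * \<eta> s \<le> E * exp r\<close>.\<close>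
    define a where "a = m * exp (-r)"
    have a: "a > 0" "a \<le> m" using m r by (auto simp: a_def)
    define v where "v s = max (\<phi> s) a" for s
    have [measurable]: "v \<in> borel_measurable N" unfolding v_def by simp
    have v: "a \<le> v s" "v s \<le> m" if "s \<in> space N" for s using \<phi>m[OF that] a by (auto simp: v_def)
    have v\<eta>: "v s * \<eta> s \<le> E" if "s \<in> space N" for s
    proof -
      have "a * \<eta> s = (m * \<eta> s) * exp (-r)" by (simp add: a_def)
      also have "\<dots> \<le> E * exp r * exp (-r)" using m\<eta>[OF that] by (intro mult_right_mono) auto
      also have "\<dots> = E" by (simp add: exp_minus)
      finally show ?thesis using same[OF that] by (auto simp: v_def max_def)
    qed
    \<comment> \<open>The chord of the convex function \<open>1/v\<close> over \<open>[a, m]\<close> lies above it.\<close>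
    have \<eta>v: "\<eta> s \<le> E * (a + m - v s) / (a * m)" if s: "s \<in> space N" for s
    proof -
      have "0 \<le> (v s - a) * (m - v s)" using v[OF s] by simp
      then have *: "a * m \<le> v s * (a + m - v s)" by (simp add: algebra_simps)
      have "\<eta> s * (a * m) \<le> \<eta> s * (v s * (a + m - v s))"
        using * \<eta>0[OF s] by (intro mult_left_mono)
      also have "\<dots> = (v s * \<eta> s) * (a + m - v s)" by simp
      also have "\<dots> \<le> E * (a + m - v s)" using v\<eta>[OF s] v[OF s] a by (intro mult_right_mono) auto
      finally show ?thesis using a m by (simp add: field_simps)
    qed
    have intv: "integrable N v"
    proof (rule int_bdd)
      show "0 \<le> v s" "v s \<le> m" if "s \<in> space N" for s using v[OF that] a by auto
    qed simp
    define I where "I = (\<integral>s. v s \<partial>N)"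
    have "(\<integral>s. \<eta> s \<partial>N) \<le> (\<integral>s. E * (a + m - v s) / (a * m) \<partial>N)"
      using int(2) intv by (intro integral_mono \<eta>v) simp_all
    also have "\<dots> = E * (a + m - I) / (a * m)"
      using intv by (simp add: I_def N.prob_space)
    finally have 1: "(\<integral>s. \<eta> s \<partial>N) \<le> E * (a + m - I) / (a * m)" .
    have 2: "(\<integral>s. \<phi> s \<partial>N) \<le> I"
      unfolding I_def using int(1) intv by (intro integral_mono) (simp_all add: v_def)
    have 3: "0 \<le> (\<integral>s. \<phi> s \<partial>N)" "0 \<le> (\<integral>s. \<eta> s \<partial>N)"
      using \<phi>0 \<eta>0 by (auto intro!: integral_nonneg_AE)
    have "(\<integral>s. \<phi> s \<partial>N) * (\<integral>s. \<eta> s \<partial>N) \<le> I * (E * (a + m - I) / (a * m))"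
      using 1 2 3 by (intro mult_mono) auto
    also have "\<dots> = E * (I * (a + m - I) / (a * m))" by simp
    also have "\<dots> \<le> E * exp (r\<^sup>2 / 4)"
    proof (intro mult_left_mono E)
      \<comment> \<open>The two factors have the fixed sum \<open>a + m\<close>, so their product is
        largest when they are equal; the resulting bound no longer depends on the mean
        \<open>I\<close>.\<close>
      have "4 * (I * (a + m - I)) \<le> (a + m)\<^sup>2"
        using zero_le_power2[of "2 * I - (a + m)"] by (simp add: power2_eq_square algebra_simps)
      then have "I * (a + m - I) / (a * m) \<le> (a + m)\<^sup>2 / 4 / (a * m)"
        using a m by (intro divide_right_mono) auto
      also have "\<dots> = ((1 + exp r) / 2)\<^sup>2 / exp r"
        using m by (simp add: a_def exp_minus field_simps power2_eq_square)
      also have "\<dots> \<le> (exp (r\<^sup>2 / 8 + r / 2))\<^sup>2 / exp r"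
      proof (intro divide_right_mono power_mono)
        \<comment> \<open>Hoeffding's lemma for a fair coin with values 0 and 1: after centring by
          r/2 the logarithmic moment generating function is at most r^2/8.\<close>
        have "ln ((1 + exp r) / 2) \<le> r\<^sup>2 / 8 + r / 2"
          using Hoeffdings_lemma_aux[of r "1/2"] r by (simp add: field_simps)
        then show "(1 + exp r) / 2 \<le> exp (r\<^sup>2 / 8 + r / 2)"
          by (metis add_pos_pos exp_gt_zero exp_le_cancel_iff exp_ln half_gt_zero_iff zero_less_one)
      qed (auto simp: add_nonneg_nonneg)
      also have "\<dots> = exp (r\<^sup>2 / 4)"
        by (simp add: exp_double[symmetric] exp_diff[symmetric] field_simps)
      finally show "I * (a + m - I) / (a * m) \<le> exp (r\<^sup>2 / 4)" .
    qed
    finally show ?thesis .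
  qed
qed

abbreviation hamming :: "'i set \<Rightarrow> ('i \<Rightarrow> 'a) \<Rightarrow> ('i \<Rightarrow> 'a) \<Rightarrow> real" where
  "hamming I x y \<equiv> real (card {i \<in> I. x i \<noteq> y i})"

lemma hamming_insert_upd:
  assumes "finite I" "i \<notin> I"
  shows "hamming (insert i I) (x(i := s)) (y(i := t)) = hamming I x y + of_bool (s \<noteq> t)"
proof -
  have "{j \<in> insert i I. (x(i := s)) j \<noteq> (y(i := t)) j} =
      (if s \<noteq> t then insert i {j \<in> I. x j \<noteq> y j} else {j \<in> I. x j \<noteq> y j})"
    using assms by auto
  then show ?thesis using assms by simp
qed

text \<open>Induction on the number of coordinates. For fixed \<open>x\<close> and \<open>y\<close>
  the one-point inequality applies to the sections of \<open>f\<close> at \<open>x\<close> and of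
  \<open>h\<close> at \<open>y\<close>, so integrating out the new coordinate reproduces the
  hypothesis with \<open>E\<close> enlarged by the factor exp(r^2/4). Functions take the place of
  sets because partial integrals of indicators are no longer indicators.\<close>

lemma hamming_functional_inequality:
  fixes f h :: "('i \<Rightarrow> 'a) \<Rightarrow> real"
  assumes "finite I" and N: "prob_space N" and r: "0 \<le> r"
    and "f \<in> borel_measurable (Pi\<^sub>M I (\<lambda>_. N))" "h \<in> borel_measurable (Pi\<^sub>M I (\<lambda>_. N))"
    and "\<And>x. x \<in> space (Pi\<^sub>M I (\<lambda>_. N)) \<Longrightarrow> 0 \<le> f x \<and> f x \<le> C"
    and "\<And>x. x \<in> space (Pi\<^sub>M I (\<lambda>_. N)) \<Longrightarrow> 0 \<le> h x \<and> h x \<le> C"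
    and "0 \<le> E"
    and "\<And>x y. x \<in> space (Pi\<^sub>M I (\<lambda>_. N)) \<Longrightarrow> y \<in> space (Pi\<^sub>M I (\<lambda>_. N)) \<Longrightarrow>
           f x * h y \<le> E * exp (r * hamming I x y)"
  shows "(\<integral>x. f x \<partial>Pi\<^sub>M I (\<lambda>_. N)) * (\<integral>x. h x \<partial>Pi\<^sub>M I (\<lambda>_. N)) \<le> E * exp (real (card I) * r\<^sup>2 / 4)"
  using \<open>finite I\<close> assms(4-)
proof (induction I arbitrary: f h E rule: finite_induct)
  case empty
  interpret product_prob_space "\<lambda>_. N" "{} :: 'i set"
    using N by (simp add: product_prob_spaceI)
  have "(\<integral>x. f x \<partial>Pi\<^sub>M {} (\<lambda>_. N)) = f (\<lambda>_. undefined)" "(\<integral>x. h x \<partial>Pi\<^sub>M {} (\<lambda>_. N)) = h (\<lambda>_. undefined)"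
    by (simp_all add: PiM_empty lebesgue_integral_count_space_finite)
  then show ?case using empty.prems(6)[of "\<lambda>_. undefined" "\<lambda>_. undefined"] by simp
next
  case (insert i I)
  interpret N: prob_space N by fact
  interpret product_prob_space "\<lambda>_. N" "I"
    using N by (simp add: product_prob_spaceI)
  note [measurable] = insert.prems(1,2)
  let ?P = "Pi\<^sub>M I (\<lambda>_. N)" and ?Q = "Pi\<^sub>M (insert i I) (\<lambda>_. N)"
  interpret P: prob_space ?P by (rule prob_space_PiM) (rule N)
  interpret Q: prob_space ?Q by (rule prob_space_PiM) (rule N)
  have upd: "x(i := s) \<in> space ?Q" if "x \<in> space ?P" "s \<in> space N" for x s
    using that by (auto simp: space_PiM PiE_iff extensional_def)
  have upd_meas [measurable]: "(\<lambda>(x, s). x(i := s)) \<in> measurable (?P \<Otimes>\<^sub>M N) ?Q"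
    using measurable_add_dim[of i I "\<lambda>_. N"] by simp
  have meas_s: "(\<lambda>s. x(i := s)) \<in> measurable N ?Q" if "x \<in> space ?P" for x
    using measurable_compose[OF measurable_Pair1'[OF that] upd_meas] by simp
  have f: "0 \<le> f (x(i := s))" "f (x(i := s)) \<le> C" if "x \<in> space ?P" "s \<in> space N" for x s
    using insert.prems(3)[OF upd[OF that]] by blast+
  have h: "0 \<le> h (x(i := s))" "h (x(i := s)) \<le> C" if "x \<in> space ?P" "s \<in> space N" for x s
    using insert.prems(4)[OF upd[OF that]] by blast+
  have intf: "integrable ?Q f" and inth: "integrable ?Q h"
    using insert.prems(3,4) by (auto intro!: Q.integrable_const_bound[where B=C])
  define F where "F x = (\<integral>s. f (x(i := s)) \<partial>N)" for x
  define H where "H x = (\<integral>s. h (x(i := s)) \<partial>N)" for x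
  have [measurable]: "F \<in> borel_measurable ?P" "H \<in> borel_measurable ?P"
    unfolding F_def H_def by measurable
  have sec: "integrable N (\<lambda>s. g (x(i := s)))" if "x \<in> space ?P" "g \<in> borel_measurable ?Q"
      "\<And>s. s \<in> space N \<Longrightarrow> 0 \<le> g (x(i := s))" "\<And>s. s \<in> space N \<Longrightarrow> g (x(i := s)) \<le> C" for x and g :: "('i \<Rightarrow> 'a) \<Rightarrow> real"
    using that measurable_compose[OF meas_s[OF that(1)] that(2)]
    by (intro N.integrable_const_bound[where B=C]) auto
  have FH: "0 \<le> F x \<and> F x \<le> C" "0 \<le> H x \<and> H x \<le> C" if x: "x \<in> space ?P" for x
    unfolding F_def H_def using f[OF x] h[OF x] sec[OF x] insert.prems(1,2)
    by (auto intro!: integral_nonneg_AE N.integral_le_const)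
  have "(\<integral>x. F x \<partial>?P) * (\<integral>x. H x \<partial>?P) \<le> (E * exp (r\<^sup>2 / 4)) * exp (real (card I) * r\<^sup>2 / 4)"
  proof (rule insert.IH)
    fix x y assume x: "x \<in> space ?P" and y: "y \<in> space ?P"
    have "F x * H y \<le> (E * exp (r * hamming I x y)) * exp (r\<^sup>2 / 4)"
      unfolding F_def H_def
    proof (rule one_point_functional_inequality[OF N])
      have FH_le: "f (x(i := s)) * h (y(i := t)) \<le> E * exp (r * (hamming I x y + of_bool (s \<noteq> t)))"
        if "s \<in> space N" "t \<in> space N" for s t
        unfolding hamming_insert_upd[OF insert.hyps, symmetric]
        by (rule insert.prems(6)[OF upd[OF x that(1)] upd[OF y that(2)]])
      show "f (x(i := s)) * h (y(i := s)) \<le> E * exp (r * hamming I x y)" if "s \<in> space N" for s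
        using FH_le[OF that that] by simp
      fix s t assume st: "s \<in> space N" "t \<in> space N"
      have "f (x(i := s)) * h (y(i := t)) \<le> E * exp (r * (hamming I x y + of_bool (s \<noteq> t)))"
        by (rule FH_le[OF st])
      also have "\<dots> \<le> E * exp (r * (hamming I x y + 1))"
        using insert.prems(5) r by (intro mult_left_mono iffD2[OF exp_le_cancel_iff]) auto
      finally show "f (x(i := s)) * h (y(i := t)) \<le> E * exp (r * hamming I x y) * exp r"
        by (simp add: ring_distribs exp_add)
    qed (use x y f h insert.prems(5) r measurable_compose[OF meas_s] in auto)
    then show "F x * H y \<le> E * exp (r\<^sup>2 / 4) * exp (r * hamming I x y)"
      by (simp add: mult_ac)
  qed (use FH insert.prems(5) in auto)
  moreover have "(\<integral>x. F x \<partial>?P) = (\<integral>x. f x \<partial>?Q)" "(\<integral>x. H x \<partial>?P) = (\<integral>x. h x \<partial>?Q)"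
    unfolding F_def H_def using product_integral_insert[OF insert.hyps intf] product_integral_insert[OF insert.hyps inth]
    by simp_all
  ultimately show ?case using insert.hyps
    by (simp add: exp_add[symmetric] add_divide_distrib algebra_simps)
qed

text \<open>Sets at Hamming distance at least \<open>t\<close> have indicators whose product is
  bounded by \<open>exp (- r * t)\<close> times the exponential weight
  \<open>exp (r * hamming I x y)\<close>, for every nonnegative \<open>r\<close>. The functional
  inequality applies to this weight.\<close>

theorem product_measure_blow_up:
  assumes "finite I" "I \<noteq> {}" and N: "prob_space N" and t: "0 \<le> t"
    and A: "A \<in> sets (Pi\<^sub>M I (\<lambda>_. N))" and B: "B \<in> sets (Pi\<^sub>M I (\<lambda>_. N))"
    and far: "\<And>x y. x \<in> A \<Longrightarrow> y \<in> B \<Longrightarrow> t \<le> hamming I x y"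
  shows "measure (Pi\<^sub>M I (\<lambda>_. N)) A * measure (Pi\<^sub>M I (\<lambda>_. N)) B \<le> exp (- t\<^sup>2 / card I)"
proof -
  let ?P = "Pi\<^sub>M I (\<lambda>_. N)"
  interpret P: prob_space ?P by (rule prob_space_PiM) (rule N)
  have n: "card I > 0" using assms by (simp add: card_gt_0_iff)
  \<comment> \<open>This value minimises the exponent
    \<open>- r * t + card I * r\<^sup>2 / 4\<close>; the minimum is
    \<open>- t\<^sup>2 / card I\<close>.\<close>
  define r where "r = 2 * t / card I"
  have r: "r \<ge> 0" using t by (simp add: r_def)
  have "(\<integral>x. indicator A x \<partial>?P) * (\<integral>x. indicator B x \<partial>?P) \<le>
      exp (- r * t) * exp (real (card I) * r\<^sup>2 / 4)"
  proof (rule hamming_functional_inequality[OF \<open>finite I\<close> N r, where C=1])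
    fix x y show "indicat_real A x * indicator B y \<le> exp (- r * t) * exp (r * hamming I x y)"
      using far[of x y] r by (auto simp: indicator_def exp_add[symmetric] intro!: mult_left_mono)
  qed (use A B in \<open>auto simp: indicator_def\<close>)
  also have "\<dots> = exp (- t\<^sup>2 / card I)"
    using n by (simp add: exp_add[symmetric] r_def power2_eq_square field_simps)
  finally show ?thesis using sets.sets_into_space[OF A] sets.sets_into_space[OF B]
    by (simp add: Int_absorb2)
qed

section \<open>Nearest neighbour indices\<close>

lemma nn_index_Least_ex:
  fixes n i :: nat and x :: "nat \<Rightarrow> 'a::metric_space"
  assumes "2 \<le> n"
  shows "\<exists>j. j \<in> {1..n} - {i} \<and> (\<forall>l \<in> {1..n} - {i}. dist (x i) (x j) \<le> dist (x i) (x l))"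
proof -
  have "(if i = 1 then 2 else 1) \<in> {1..n} - {i}" using assms by auto
  then have "{1..n} - {i} \<noteq> {}" by blast
  then show ?thesis
    using arg_min_if_finite(1)[of "{1..n} - {i}" "\<lambda>j. dist (x i) (x j)"]
      arg_min_least[of "{1..n} - {i}" _ "\<lambda>j. dist (x i) (x j)"] by blast
qed

lemma nn_index_mem:
  assumes "2 \<le> n"
  shows "nn_index n x i \<in> {1..n} - {i}"
  unfolding nn_index_def using LeastI_ex[OF nn_index_Least_ex[OF assms, of i x]] by blast

lemma nn_index_nearest:
  assumes "2 \<le> n" "l \<in> {1..n} - {i}"
  shows "dist (x i) (x (nn_index n x i)) \<le> dist (x i) (x l)"
  unfolding nn_index_def using LeastI_ex[OF nn_index_Least_ex[OF assms(1), of i x]] assms(2) by blast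

lemma nn_index_le:
  assumes "j \<in> {1..n} - {i}" "\<And>l. l \<in> {1..n} - {i} \<Longrightarrow> dist (x i) (x j) \<le> dist (x i) (x l)"
  shows "nn_index n x i \<le> j"
  unfolding nn_index_def using assms by (intro Least_le) blast

text \<open>Agreement at three points is enough: at \<open>i\<close> and at the two neighbours of
  \<open>i\<close>. The distances from \<open>i\<close> to both neighbours are then the same in the
  two samples, so the neighbour taken from \<open>x'\<close> is also a minimiser for
  \<open>x\<close> and competes for the least index. Exchanging the roles gives equality, including
  the tie-breaking.\<close>

lemma nn_index_unaffected_le:
  assumes n: "2 \<le> n" and eq: "x i = x' i" "x (nn_index n x i) = x' (nn_index n x i)"
    "x (nn_index n x' i) = x' (nn_index n x' i)"
  shows "nn_index n x i \<le> nn_index n x' i"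
proof (rule nn_index_le)
  let ?a = "nn_index n x i" and ?b = "nn_index n x' i"
  show b: "?b \<in> {1..n} - {i}" by (rule nn_index_mem[OF n])
  fix l assume l: "l \<in> {1..n} - {i}"
  have "dist (x i) (x ?b) \<le> dist (x i) (x ?a)"
    using nn_index_nearest[OF n nn_index_mem[OF n], of x' i x] eq by simp
  also have "\<dots> \<le> dist (x i) (x l)" by (rule nn_index_nearest[OF n l])
  finally show "dist (x i) (x ?b) \<le> dist (x i) (x l)" .
qed

lemma nn_index_unaffected:
  assumes "2 \<le> n" "x i = x' i" "x (nn_index n x i) = x' (nn_index n x i)"
    "x (nn_index n x' i) = x' (nn_index n x' i)"
  shows "nn_index n x i = nn_index n x' i"
  using nn_index_unaffected_le[of n x i x'] nn_index_unaffected_le[of n x' i x] assms by simp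

lemma nn_index_cong:
  assumes "\<And>j. j \<in> {1..n} \<Longrightarrow> x j = x' j" "i \<in> {1..n}"
  shows "nn_index n x i = nn_index n x' i"
  unfolding nn_index_def using assms by (intro arg_cong[where f=Least] ext) auto

lemma max_indegree_cong:
  assumes "\<And>j. j \<in> {1..n} \<Longrightarrow> x j = x' j"
  shows "max_indegree n x = max_indegree n x'"
proof -
  have "{j \<in> {1..n}. nn_index n x j = i} = {j \<in> {1..n}. nn_index n x' j = i}" for i
    using nn_index_cong[of n x x', OF assms] by auto
  then show ?thesis by (simp add: max_indegree_def)
qed

lemma indegree_le_max_indegree:
  assumes "i \<in> {1..n}"
  shows "card {j \<in> {1..n}. nn_index n x j = i} \<le> max_indegree n x"
  unfolding max_indegree_def using assms by (intro Max_ge) auto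

text \<open>Relabelling must keep the order of the remaining points, because ties are broken by index.\<close>

lemma nn_index_reindex:
  assumes n: "2 \<le> n" and a: "a \<in> {1..n}" and bij: "bij_betw \<sigma> {1..n} {1..n}"
    and mono: "strict_mono_on ({1..n} - {a}) \<sigma>"
  shows "nn_index n x (\<sigma> a) = \<sigma> (nn_index n (\<lambda>j. x (\<sigma> j)) a)"
proof (rule antisym)
  let ?b = "nn_index n (\<lambda>j. x (\<sigma> j)) a"
  have im: "\<sigma> ` ({1..n} - {a}) = {1..n} - {\<sigma> a}"
    using inj_on_image_set_diff[of \<sigma> "{1..n}" "{1..n}" "{a}"] bij a by (simp add: bij_betw_def)
  have b: "?b \<in> {1..n} - {a}" by (rule nn_index_mem[OF n])
  show "nn_index n x (\<sigma> a) \<le> \<sigma> ?b"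
  proof (rule nn_index_le)
    show "\<sigma> ?b \<in> {1..n} - {\<sigma> a}" using b im by blast
    fix l assume "l \<in> {1..n} - {\<sigma> a}"
    then obtain l' where "l' \<in> {1..n} - {a}" "l = \<sigma> l'" using im by blast
    then show "dist (x (\<sigma> a)) (x (\<sigma> ?b)) \<le> dist (x (\<sigma> a)) (x l)"
      using nn_index_nearest[OF n, of l' a "\<lambda>j. x (\<sigma> j)"] by simp
  qed
  obtain c where c: "c \<in> {1..n} - {a}" "nn_index n x (\<sigma> a) = \<sigma> c"
    using nn_index_mem[OF n, of x "\<sigma> a"] im by (metis image_iff)
  have "?b \<le> c"
  proof (rule nn_index_le[OF c(1)])
    fix l assume l: "l \<in> {1..n} - {a}"
    then have "\<sigma> l \<in> {1..n} - {\<sigma> a}" using im by blast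
    then show "dist (x (\<sigma> a)) (x (\<sigma> c)) \<le> dist (x (\<sigma> a)) (x (\<sigma> l))"
      using nn_index_nearest[OF n, of "\<sigma> l" "\<sigma> a" x] c(2) by simp
  qed
  then show "\<sigma> ?b \<le> nn_index n x (\<sigma> a)"
    using mono b c by (simp add: strict_mono_on_leD)
qed

lemma p2_hat_nonneg: "0 \<le> p2_hat n y N k l"
  by (simp add: p2_hat_def sum_nonneg)

lemma p2_hat_le_1: "p2_hat n y N k l \<le> 1"
proof -
  have "(\<Sum>i=1..n. of_bool (y i = k \<and> y (N i) = l)) \<le> (\<Sum>i=1..n. 1 :: real)"
    by (intro sum_mono) simp
  then show ?thesis by (simp add: p2_hat_def divide_le_eq)
qed

lemma card_nn_vimage_le:
  assumes "S \<subseteq> {1..n}"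
  shows "card {j \<in> {1..n}. nn_index n x j \<in> S} \<le> card S * max_indegree n x"
proof -
  have "{j \<in> {1..n}. nn_index n x j \<in> S} = (\<Union>i\<in>S. {j \<in> {1..n}. nn_index n x j = i})" by auto
  also have "card \<dots> \<le> (\<Sum>i\<in>S. card {j \<in> {1..n}. nn_index n x j = i})"
    using assms by (intro card_UN_le finite_subset[OF assms]) simp
  also have "\<dots> \<le> (\<Sum>i\<in>S. max_indegree n x)"
    using assms by (intro sum_mono indegree_le_max_indegree) auto
  finally show ?thesis by simp
qed

text \<open>A summand can change only if its own index, its neighbour under \<open>x\<close> or its
  neighbour under \<open>x'\<close> lies in the set \<open>S\<close> of altered observations. The
  first happens for \<open>card S\<close> indices, each of the others for at most
  \<open>c * card S\<close>, since no point is the neighbour of more than \<open>c\<close> others in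
  either sample.\<close>

lemma p2_hat_lipschitz:
  fixes x x' :: "nat \<Rightarrow> 'a::metric_space" and c :: real
  assumes n: "2 \<le> n" and L: "max_indegree n x \<le> c" "max_indegree n x' \<le> c"
    and eq: "\<And>i. i \<in> {1..n} - S \<Longrightarrow> x i = x' i \<and> y i = y' i" and S: "S \<subseteq> {1..n}"
  shows "p2_hat n y (nn_index n x) k l - p2_hat n y' (nn_index n x') k l \<le> (1 + 2 * c) / n * card S"
proof -
  let ?N = "nn_index n x" and ?N' = "nn_index n x'"
  let ?T = "S \<union> {j \<in> {1..n}. ?N j \<in> S} \<union> {j \<in> {1..n}. ?N' j \<in> S}"
  have [simp]: "finite S" using S finite_subset by blast
  have same: "(y i = k \<and> y (?N i) = l) = (y' i = k \<and> y' (?N' i) = l)" if i: "i \<in> {1..n}" "i \<notin> ?T" for i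
  proof -
    have "?N i \<in> {1..n} - S" "?N' i \<in> {1..n} - S" "i \<in> {1..n} - S"
      using nn_index_mem[OF n, of x i] nn_index_mem[OF n, of x' i] i by auto
    then show ?thesis using nn_index_unaffected[OF n, of x i x'] eq by auto
  qed
  have "(\<Sum>i=1..n. of_bool (y i = k \<and> y (?N i) = l)) - (\<Sum>i=1..n. of_bool (y' i = k \<and> y' (?N' i) = l)) =
      (\<Sum>i=1..n. of_bool (y i = k \<and> y (?N i) = l) - of_bool (y' i = k \<and> y' (?N' i) = l) :: real)"
    by (simp add: sum_subtractf)
  also have "\<dots> \<le> (\<Sum>i=1..n. of_bool (i \<in> ?T))"
    using same by (intro sum_mono) (auto simp: of_bool_def)
  also have "\<dots> = card ({1..n} \<inter> ?T)" by (subst sum_of_bool_eq) (simp_all add: Int_def)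
  also have "{1..n} \<inter> ?T = ?T" using S by auto
  also have "real (card ?T) \<le> real (card S + card {j \<in> {1..n}. ?N j \<in> S} + card {j \<in> {1..n}. ?N' j \<in> S})"
    by (intro of_nat_mono order_trans[OF card_Un_le] add_right_mono card_Un_le)
  also have "\<dots> \<le> card S + card S * c + card S * c"
  proof -
    have *: "real (card {j \<in> {1..n}. nn_index n z j \<in> S}) \<le> card S * c" if "max_indegree n z \<le> c" for z :: "nat \<Rightarrow> 'a"
    proof -
      have "real (card {j \<in> {1..n}. nn_index n z j \<in> S}) \<le> real (card S * max_indegree n z)"
        using card_nn_vimage_le[OF S] by (rule of_nat_mono)
      also have "\<dots> \<le> card S * c" using that by (simp add: mult_left_mono)
      finally show ?thesis .
    qed
    show ?thesis unfolding of_nat_add by (intro add_mono order_refl * L)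
  qed
  also have "\<dots> = (1 + 2 * c) * card S" by (simp add: algebra_simps)
  finally show ?thesis
    using n by (simp add: p2_hat_def diff_divide_distrib[symmetric] divide_right_mono)
qed

lemma measurable_nn_index:
  fixes X :: "nat \<Rightarrow> 'w \<Rightarrow> 'a::{metric_space, second_countable_topology}"
  assumes [measurable]: "\<And>j. j \<in> {1..n} \<Longrightarrow> X j \<in> borel_measurable M" and i: "i \<in> {1..n}"
  shows "(\<lambda>\<omega>. nn_index n (\<lambda>j. X j \<omega>) i) \<in> measurable M (count_space UNIV)"
  unfolding nn_index_def
proof (rule measurable_Least)
  fix j show "Measurable.pred M (\<lambda>\<omega>. j \<in> {1..n} - {i} \<and>
      (\<forall>l\<in>{1..n} - {i}. dist (X i \<omega>) (X j \<omega>) \<le> dist (X i \<omega>) (X l \<omega>)))"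
  proof (cases "j \<in> {1..n} - {i}")
    case True
    have "Measurable.pred M (\<lambda>\<omega>. dist (X i \<omega>) (X j \<omega>) \<le> dist (X i \<omega>) (X l \<omega>))" if "l \<in> {1..n} - {i}" for l
    proof -
      have [measurable]: "X i \<in> borel_measurable M" "X j \<in> borel_measurable M" "X l \<in> borel_measurable M"
        using that True i by (auto intro: assms)
      show ?thesis by measurable
    qed
    then show ?thesis using True by (intro pred_intros_logic pred_intros_finite) simp_all
  qed simp
qed

text \<open>The maximum reaches \<open>c\<close> iff one of finitely many in-degrees does, and each
  in-degree is a finite sum of indicators. The ceiling moves the real threshold to the naturals,
  where the maximum over a finite nonempty set can be split.\<close>

lemma measurable_max_indegree:
  fixes X :: "nat \<Rightarrow> 'w \<Rightarrow> 'a::{metric_space, second_countable_topology}"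
  assumes X: "\<And>j. j \<in> {1..n} \<Longrightarrow> X j \<in> borel_measurable M" and n: "1 \<le> n"
  shows "Measurable.pred M (\<lambda>\<omega>. c \<le> real (max_indegree n (\<lambda>j. X j \<omega>)))"
proof -
  have N [measurable]: "(\<lambda>\<omega>. nn_index n (\<lambda>j. X j \<omega>) i) \<in> measurable M (count_space UNIV)" if "i \<in> {1..n}" for i
    using measurable_nn_index[OF X that] .
  have eq: "c \<le> real (max_indegree n (\<lambda>j. X j \<omega>)) \<longleftrightarrow>
      (\<exists>i\<in>{1..n}. c \<le> (\<Sum>j=1..n. of_bool (nn_index n (\<lambda>j. X j \<omega>) j = i)))" for \<omega>
  proof -
    have "real (card {j \<in> {1..n}. nn_index n (\<lambda>j. X j \<omega>) j = i}) =
        (\<Sum>j=1..n. of_bool (nn_index n (\<lambda>j. X j \<omega>) j = i))" for i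
      by (simp add: Int_def)
    then have *: "nat \<lceil>c\<rceil> \<le> card {j \<in> {1..n}. nn_index n (\<lambda>j. X j \<omega>) j = i} \<longleftrightarrow>
        c \<le> (\<Sum>j=1..n. of_bool (nn_index n (\<lambda>j. X j \<omega>) j = i))" for i
      unfolding nat_ceiling_le_eq by simp
    have "c \<le> real (max_indegree n (\<lambda>j. X j \<omega>)) \<longleftrightarrow> nat \<lceil>c\<rceil> \<le> max_indegree n (\<lambda>j. X j \<omega>)"
      unfolding nat_ceiling_le_eq ..
    also have "\<dots> \<longleftrightarrow> (\<exists>i\<in>{1..n}. nat \<lceil>c\<rceil> \<le> card {j \<in> {1..n}. nn_index n (\<lambda>j. X j \<omega>) j = i})"
      unfolding max_indegree_def using n by (subst Max_ge_iff) simp_all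
    finally show ?thesis unfolding * .
  qed
  have "(\<lambda>\<omega>. of_bool (nn_index n (\<lambda>j. X j \<omega>) j = i) :: real) \<in> borel_measurable M" if "j \<in> {1..n}" for i j
    using that by measurable
  then have "(\<lambda>\<omega>. \<Sum>j=1..n. of_bool (nn_index n (\<lambda>j. X j \<omega>) j = i) :: real) \<in> borel_measurable M" for i
    by (intro borel_measurable_sum)
  then have P: "Measurable.pred M (\<lambda>\<omega>. c \<le> (\<Sum>j=1..n. of_bool (nn_index n (\<lambda>j. X j \<omega>) j = i)))" for i
    by measurable
  show ?thesis
    unfolding eq by (intro pred_intros_finite finite_atLeastAtMost P)
qed

text \<open>Evaluation of a random sequence at the random neighbour index. For
  \<open>2 \<le> n\<close> the index stays in the finite set \<open>{1..n}\<close>, so measurability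
  of \<open>F j\<close> on that range suffices.\<close>

lemma measurable_label_nn:
  fixes X :: "nat \<Rightarrow> 'w \<Rightarrow> 'a::{metric_space, second_countable_topology}" and F :: "nat \<Rightarrow> 'w \<Rightarrow> 'b"
  assumes X: "\<And>j. j \<in> {1..n} \<Longrightarrow> X j \<in> borel_measurable M"
    and F: "\<And>j. j \<in> {1..n} \<Longrightarrow> F j \<in> measurable M N" and n: "2 \<le> n" and i: "i \<in> {1..n}"
  shows "(\<lambda>\<omega>. F (nn_index n (\<lambda>j. X j \<omega>) i) \<omega>) \<in> measurable M N"
proof (rule measurable_compose_countable'[where I="{1..n}"])
  have N: "(\<lambda>\<omega>. nn_index n (\<lambda>j. X j \<omega>) i) \<in> measurable M (count_space UNIV)"
    by (rule measurable_nn_index[OF X i])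
  show "(\<lambda>\<omega>. nn_index n (\<lambda>j. X j \<omega>) i) \<in> measurable M (count_space {1..n})"
  proof (rule measurableI)
    show "nn_index n (\<lambda>j. X j \<omega>) i \<in> space (count_space {1..n})" for \<omega>
      using nn_index_mem[OF n, of "\<lambda>j. X j \<omega>" i] by simp
  qed (use measurable_sets[OF N] in simp)
qed (use F in simp_all)

lemma measurable_p2_hat:
  fixes X :: "nat \<Rightarrow> 'w \<Rightarrow> 'a::{metric_space, second_countable_topology}" and Y :: "nat \<Rightarrow> 'w \<Rightarrow> nat"
  assumes X: "\<And>j. j \<in> {1..n} \<Longrightarrow> X j \<in> borel_measurable M"
    and Y [measurable]: "\<And>j. j \<in> {1..n} \<Longrightarrow> Y j \<in> measurable M (count_space UNIV)" and n: "2 \<le> n"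
  shows "(\<lambda>\<omega>. p2_hat n (\<lambda>i. Y i \<omega>) (nn_index n (\<lambda>i. X i \<omega>)) k l) \<in> borel_measurable M"
  unfolding p2_hat_def
proof (intro borel_measurable_times borel_measurable_sum borel_measurable_const)
  fix i assume i: "i \<in> {1..n}"
  have [measurable]: "(\<lambda>\<omega>. Y (nn_index n (\<lambda>j. X j \<omega>) i) \<omega>) \<in> measurable M (count_space UNIV)"
    by (rule measurable_label_nn[OF X Y n i])
  show "(\<lambda>\<omega>. of_bool (Y i \<omega> = k \<and> Y (nn_index n (\<lambda>j. X j \<omega>) i) \<omega> = l)) \<in> borel_measurable M"
    using i by measurable
qed

section \<open>Concentration of almost Lipschitz functions\<close>

text \<open>The good points with \<open>g\<close> below the mean plus \<open>\<epsilon> / 2\<close>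
  (\<open>A\<close>) and the good points with \<open>g\<close> at least the mean plus
  \<open>\<epsilon>\<close> (\<open>B\<close>) are at Hamming distance at least
  \<open>\<epsilon> / (2 * c)\<close>, so the blow-up inequality bounds the product of their
  probabilities. A lower bound on the probability of \<open>A\<close> then makes \<open>B\<close>
  unlikely, and the points that are not good are added at the end.\<close>

lemma product_upper_tail:
  fixes g :: "('i \<Rightarrow> 'a) \<Rightarrow> real" and N :: "'a measure" and I :: "'i set"
  defines "P \<equiv> Pi\<^sub>M I (\<lambda>_. N)"
  assumes I: "finite I" "I \<noteq> {}" and N: "prob_space N"
    and g [measurable]: "g \<in> borel_measurable P" and good [measurable]: "Measurable.pred P good"
    and g0: "\<And>z. z \<in> space P \<Longrightarrow> 0 \<le> g z" and g1: "\<And>z. z \<in> space P \<Longrightarrow> g z \<le> 1"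
    and c: "0 < c" and \<epsilon>: "0 < \<epsilon>"
    and lip: "\<And>z z'. z \<in> space P \<Longrightarrow> z' \<in> space P \<Longrightarrow> good z \<Longrightarrow> good z' \<Longrightarrow>
               g z - g z' \<le> c * hamming I z z'"
    and bad: "measure P {z \<in> space P. \<not> good z} \<le> \<epsilon> / (2 * (2 + \<epsilon>))"
  shows "measure P {z \<in> space P. (\<integral>z. g z \<partial>P) + \<epsilon> \<le> g z} \<le>
           measure P {z \<in> space P. \<not> good z} + 2 * (2 + \<epsilon>) / \<epsilon> * exp (- \<epsilon>\<^sup>2 / (4 * c\<^sup>2 * card I))"
proof -
  interpret P: prob_space P unfolding P_def by (rule prob_space_PiM) (rule N)
  define e where "e = (\<integral>z. g z \<partial>P)"
  have intg: "integrable P g" using g0 g1 by (intro P.integrable_const_bound[where B=1]) auto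
  have e0: "0 \<le> e" unfolding e_def using g0 by (intro integral_nonneg_AE) auto
  have e1: "e \<le> 1" unfolding e_def using g1 by (intro P.integral_le_const intg) auto
  define A where "A = {z \<in> space P. g z < e + \<epsilon> / 2 \<and> good z}"
  define B where "B = {z \<in> space P. e + \<epsilon> \<le> g z \<and> good z}"
  have [measurable]: "A \<in> sets P" "B \<in> sets P" unfolding A_def B_def by measurable
  have AB: "P.prob A * P.prob B \<le> exp (- (\<epsilon> / (2 * c))\<^sup>2 / card I)"
    unfolding P_def
  proof (rule product_measure_blow_up[OF I N])
    fix x y assume "x \<in> A" "y \<in> B"
    then have "\<epsilon> / 2 \<le> c * hamming I y x" using lip[of y x] by (auto simp: A_def B_def)
    then show "\<epsilon> / (2 * c) \<le> hamming I x y" using c by (simp add: field_simps eq_commute)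
  qed (use c \<epsilon> \<open>A \<in> sets P\<close> \<open>B \<in> sets P\<close> in \<open>auto simp: P_def\<close>)
  \<comment> \<open>Markov's inequality at the level \<open>e + \<epsilon> / 2\<close>, with a mean
    \<open>e \<le> 1\<close>, leaves mass at least \<open>q\<close> below that level. The bound
    assumed for the bad set is half of this, so \<open>A\<close> keeps at least
    \<open>q / 2\<close>.\<close>
  define q where "q = \<epsilon> / (2 + \<epsilon>)"
  have q: "\<epsilon> / (2 * (2 + \<epsilon>)) = q / 2" by (simp add: q_def)
  have "P.prob {z \<in> space P. e + \<epsilon> / 2 \<le> g z} \<le> e / (e + \<epsilon> / 2)"
    unfolding e_def using integral_Markov_inequality_measure[OF intg, of "{}" "e + \<epsilon> / 2"] g0 e0 \<epsilon>
    unfolding e_def by (auto simp: add_nonneg_pos)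
  also have "\<dots> \<le> 1 / (1 + \<epsilon> / 2)"
  proof -
    have "e * \<epsilon> \<le> \<epsilon>" using e1 \<epsilon> by simp
    then show ?thesis using e0 \<epsilon> by (simp add: divide_simps algebra_simps)
  qed
  also have "\<dots> = 1 - q" using \<epsilon> by (simp add: q_def field_simps)
  finally have markov: "P.prob {z \<in> space P. e + \<epsilon> / 2 \<le> g z} \<le> 1 - q" .
  have "1 = P.prob ({z \<in> space P. e + \<epsilon> / 2 \<le> g z} \<union> A \<union> {z \<in> space P. \<not> good z})"
  proof -
    have "{z \<in> space P. e + \<epsilon> / 2 \<le> g z} \<union> A \<union> {z \<in> space P. \<not> good z} = space P"
      unfolding A_def by auto
    then show ?thesis by (simp add: P.prob_space)
  qed
  also have "\<dots> \<le> P.prob {z \<in> space P. e + \<epsilon> / 2 \<le> g z} + P.prob A + P.prob {z \<in> space P. \<not> good z}"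
    by (intro order_trans[OF measure_Un_le] add_right_mono measure_Un_le) measurable
  finally have "\<epsilon> / (2 * (2 + \<epsilon>)) \<le> P.prob A"
    using markov bad unfolding q by linarith
  then have "\<epsilon> / (2 * (2 + \<epsilon>)) * P.prob B \<le> P.prob A * P.prob B"
    by (intro mult_right_mono) auto
  also note AB
  also have "exp (- (\<epsilon> / (2 * c))\<^sup>2 / card I) = exp (- \<epsilon>\<^sup>2 / (4 * c\<^sup>2 * card I))"
    by (simp add: power2_eq_square)
  finally have "\<epsilon> / (2 * (2 + \<epsilon>)) * P.prob B \<le> exp (- \<epsilon>\<^sup>2 / (4 * c\<^sup>2 * card I))" .
  then have B: "P.prob B \<le> 2 * (2 + \<epsilon>) / \<epsilon> * exp (- \<epsilon>\<^sup>2 / (4 * c\<^sup>2 * card I))"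
    using \<epsilon> by (simp add: field_simps)
  have "P.prob {z \<in> space P. e + \<epsilon> \<le> g z} \<le> P.prob ({z \<in> space P. \<not> good z} \<union> B)"
    by (intro P.finite_measure_mono) (auto simp: B_def)
  also have "\<dots> \<le> P.prob {z \<in> space P. \<not> good z} + P.prob B"
    by (intro measure_Un_le) auto
  finally show ?thesis using B by (simp add: e_def)
qed

text \<open>The lower deviations of \<open>g\<close> are the upper deviations of
  \<open>1 - g\<close>, which has the same range and, as the Hamming distance is symmetric, the same
  Lipschitz constant.\<close>

lemma product_two_sided_tail:
  fixes g :: "('i \<Rightarrow> 'a) \<Rightarrow> real" and N :: "'a measure" and I :: "'i set"
  defines "P \<equiv> Pi\<^sub>M I (\<lambda>_. N)"
  assumes I: "finite I" "I \<noteq> {}" and N: "prob_space N"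
    and g [measurable]: "g \<in> borel_measurable P" and good [measurable]: "Measurable.pred P good"
    and g0: "\<And>z. z \<in> space P \<Longrightarrow> 0 \<le> g z" and g1: "\<And>z. z \<in> space P \<Longrightarrow> g z \<le> 1"
    and c: "0 < c" and \<epsilon>: "0 < \<epsilon>"
    and lip: "\<And>z z'. z \<in> space P \<Longrightarrow> z' \<in> space P \<Longrightarrow> good z \<Longrightarrow> good z' \<Longrightarrow>
               g z - g z' \<le> c * hamming I z z'"
    and bad: "measure P {z \<in> space P. \<not> good z} \<le> \<epsilon> / (2 * (2 + \<epsilon>))"
  shows "measure P {z \<in> space P. \<epsilon> \<le> \<bar>g z - (\<integral>z. g z \<partial>P)\<bar>} \<le>
           2 * measure P {z \<in> space P. \<not> good z} + 4 * (2 + \<epsilon>) / \<epsilon> * exp (- \<epsilon>\<^sup>2 / (4 * c\<^sup>2 * card I))"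
proof -
  interpret P: prob_space P unfolding P_def by (rule prob_space_PiM) (rule N)
  have intg: "integrable P g" using g0 g1 by (intro P.integrable_const_bound[where B=1]) auto
  have sym: "hamming I x y = hamming I y x" for x y :: "'i \<Rightarrow> 'a" by (simp add: eq_commute)
  let ?b = "measure P {z \<in> space P. \<not> good z} + 2 * (2 + \<epsilon>) / \<epsilon> * exp (- \<epsilon>\<^sup>2 / (4 * c\<^sup>2 * card I))"
  have 1: "P.prob {z \<in> space P. (\<integral>z. g z \<partial>P) + \<epsilon> \<le> g z} \<le> ?b"
    using product_upper_tail[of I N g good c \<epsilon>, folded P_def] assms(2-) by blast
  have 2: "P.prob {z \<in> space P. (\<integral>z. 1 - g z \<partial>P) + \<epsilon> \<le> 1 - g z} \<le> ?b"
  proof (rule product_upper_tail[of I N "\<lambda>z. 1 - g z" good c \<epsilon>, folded P_def])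
    fix z z' assume "z \<in> space P" "z' \<in> space P" "good z" "good z'"
    then show "1 - g z - (1 - g z') \<le> c * hamming I z z'" using lip[of z' z] sym[of z z'] by simp
  qed (use assms in auto)
  have "(\<integral>z. 1 - g z \<partial>P) = 1 - (\<integral>z. g z \<partial>P)" using intg by (simp add: P.prob_space)
  then have eq: "{z \<in> space P. \<epsilon> \<le> \<bar>g z - (\<integral>z. g z \<partial>P)\<bar>} =
      {z \<in> space P. (\<integral>z. g z \<partial>P) + \<epsilon> \<le> g z} \<union> {z \<in> space P. (\<integral>z. 1 - g z \<partial>P) + \<epsilon> \<le> 1 - g z}"
    by (auto simp: abs_if split: if_splits)
  have "P.prob {z \<in> space P. \<epsilon> \<le> \<bar>g z - (\<integral>z. g z \<partial>P)\<bar>} \<le> ?b + ?b"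
    unfolding eq by (intro order_trans[OF measure_Un_le] add_mono 1 2) measurable
  then show ?thesis by (simp add: field_simps)
qed

text \<open>The exponent is \<open>- \<epsilon>\<^sup>2 * n / (4 * (1 + 2 * k n)\<^sup>2)\<close>.
  The growth condition on \<open>k\<close> makes it eventually at most \<open>- 2 * ln n\<close>,
  which gives comparison with the series of 1/n^2.\<close>

lemma summable_exp_tail:
  fixes k :: "nat \<Rightarrow> real"
  assumes k: "k \<in> o(\<lambda>n. sqrt (real n / ln (real n)))" and \<epsilon>: "0 < \<epsilon>"
    and pos: "eventually (\<lambda>n. 0 \<le> k n) sequentially"
  shows "summable (\<lambda>n. exp (- \<epsilon>\<^sup>2 / (4 * ((1 + 2 * k n) / n)\<^sup>2 * real n)))"
proof -
  have "(\<lambda>_. 1 :: real) \<in> o(\<lambda>n::nat. sqrt (real n / ln (real n)))" by real_asymp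
  then have o: "(\<lambda>n. 1 + 2 * k n) \<in> o(\<lambda>n. sqrt (real n / ln (real n)))"
    using k by (intro sum_in_smallo) auto
  have "summable (\<lambda>n. exp (- 2 * ln (real n)))"
  proof (rule summable_cong[THEN iffD1])
    show "\<forall>\<^sub>F n in sequentially. 1 / real n ^ 2 = exp (- 2 * ln (real n))"
      using eventually_gt_at_top[of 0]
    proof eventually_elim
      case (elim n)
      have "exp (2 * ln (real n)) = (exp (ln (real n)))\<^sup>2" by (simp add: exp_double)
      then show ?case using elim by (simp add: exp_minus divide_inverse)
    qed
    show "summable (\<lambda>n. 1 / real n ^ 2)" using inverse_power_summable[of 2, where 'a=real] by (simp add: divide_inverse)
  qed
  then show ?thesis
  proof (rule summable_comparison_test_ev[rotated])
    \<comment> \<open>The factor 1/3 turns the exponent into at least 9/4 times the logarithm, which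
      exceeds the required factor 2.\<close>
    have "eventually (\<lambda>n. norm (1 + 2 * k n) \<le> \<epsilon> / 3 * norm (sqrt (real n / ln (real n)))) sequentially"
      using landau_o.smallD[OF o, of "\<epsilon> / 3"] \<epsilon> by simp
    then show "\<forall>\<^sub>F n in sequentially. norm (exp (- \<epsilon>\<^sup>2 / (4 * ((1 + 2 * k n) / n)\<^sup>2 * real n))) \<le> exp (- 2 * ln (real n))"
      using pos eventually_gt_at_top[of 1]
    proof eventually_elim
      case (elim n)
      define b where "b = 1 + 2 * k n"
      have b: "b > 0" using elim by (simp add: b_def)
      have l: "ln (real n) > 0" using elim by simp
      have "b \<le> \<epsilon> / 3 * sqrt (real n / ln (real n))" using elim b l by (simp add: b_def)
      then have "b\<^sup>2 \<le> (\<epsilon> / 3 * sqrt (real n / ln (real n)))\<^sup>2" using b by (intro power_mono) auto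
      also have "\<dots> = \<epsilon>\<^sup>2 / 9 * (real n / ln (real n))" using l by (simp add: power_mult_distrib power_divide)
      finally have "9 * b\<^sup>2 * ln (real n) \<le> \<epsilon>\<^sup>2 * real n" using l by (simp add: field_simps)
      moreover have "0 \<le> b\<^sup>2 * ln (real n)" using l by simp
      ultimately have "8 * b\<^sup>2 * ln (real n) \<le> \<epsilon>\<^sup>2 * real n" by linarith
      then have "2 * ln (real n) \<le> \<epsilon>\<^sup>2 * real n / (4 * b\<^sup>2)" using b by (simp add: field_simps)
      also have "\<dots> = \<epsilon>\<^sup>2 / (4 * (b / n)\<^sup>2 * real n)" using elim b by (simp add: field_simps power2_eq_square)
      finally show ?case by (simp add: b_def)
    qed
  qed
qed

section \<open>Mean of the estimate\<close>

lemma integrable_abs_le_const: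
  assumes "prob_space N" "g \<in> borel_measurable N" "\<And>x. x \<in> space N \<Longrightarrow> \<bar>g x\<bar> \<le> (C::real)"
  shows "integrable N g"
proof -
  interpret N: prob_space N by fact
  show ?thesis using assms by (intro N.integrable_const_bound[where B=C]) auto
qed

lemma abs_mult_le_left:
  fixes a b C :: real
  assumes "\<bar>a\<bar> \<le> C" "\<bar>b\<bar> \<le> 1"
  shows "\<bar>a * b\<bar> \<le> C"
  using mult_mono[OF assms] assms(1) by (simp add: abs_mult)

text \<open>The i.i.d. setting with an abstract measurable label function \<open>f\<close> in place
  of the threshold function. \<open>P\<close> is the law of the covariates and
  \<open>\<Lambda>\<close> the law of the independent randomisation that turns a covariate into a
  label.\<close>

locale nn_sample = prob_space M
  for M :: "'w measure" +
  fixes Xs :: "nat \<Rightarrow> 'w \<Rightarrow> 'a::{metric_space, second_countable_topology}"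
    and Us :: "nat \<Rightarrow> 'w \<Rightarrow> real"
    and P :: "'a measure" and \<Lambda> :: "real measure"
    and f :: "'a \<Rightarrow> real \<Rightarrow> nat"
  assumes P: "prob_space P" and sets_P [measurable_cong]: "sets P = sets borel"
    and \<Lambda>: "prob_space \<Lambda>" and sets_\<Lambda> [measurable_cong]: "sets \<Lambda> = sets borel"
    and f [measurable]: "case_prod f \<in> measurable (borel \<Otimes>\<^sub>M borel) (count_space UNIV)"
    and indep: "indep_vars (\<lambda>_. borel \<Otimes>\<^sub>M borel) (\<lambda>i \<omega>. (Xs i \<omega>, Us i \<omega>)) {1..}"
    and distr: "\<And>i. 1 \<le> i \<Longrightarrow> distr M (borel \<Otimes>\<^sub>M borel) (\<lambda>\<omega>. (Xs i \<omega>, Us i \<omega>)) = P \<Otimes>\<^sub>M \<Lambda>"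
begin

sublocale PX: prob_space P by (rule P)
sublocale PU: prob_space \<Lambda> by (rule \<Lambda>)
sublocale PXU: pair_prob_space P \<Lambda> ..

abbreviation Zs :: "nat \<Rightarrow> 'w \<Rightarrow> 'a \<times> real" where "Zs i \<omega> \<equiv> (Xs i \<omega>, Us i \<omega>)"

abbreviation D :: "nat \<Rightarrow> (nat \<Rightarrow> 'a \<times> real) measure" where "D n \<equiv> Pi\<^sub>M {1..n} (\<lambda>_. P \<Otimes>\<^sub>M \<Lambda>)"

text \<open>For \<open>U\<close> of law \<open>\<Lambda>\<close> independent of \<open>X\<close>
  this is the conditional probability of the label \<open>m\<close> given \<open>X = x\<close>, read
  off from the label function.\<close>

definition R :: "nat \<Rightarrow> 'a \<Rightarrow> real" where "R m x = (\<integral>u. of_bool (f x u = m) \<partial>\<Lambda>)"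

lemma space_P [simp]: "space P = UNIV" and space_\<Lambda> [simp]: "space \<Lambda> = UNIV"
  using sets_eq_imp_space_eq[OF sets_P] sets_eq_imp_space_eq[OF sets_\<Lambda>] by simp_all

lemma sets_P\<Lambda>: "sets (P \<Otimes>\<^sub>M \<Lambda>) = sets (borel \<Otimes>\<^sub>M borel)"
  using sets_P sets_\<Lambda> by (rule sets_pair_measure_cong)

lemma prob_D: "prob_space (D n)"
  by (intro prob_space_PiM PXU.prob_space_axioms)

lemma Zs_measurable: "1 \<le> i \<Longrightarrow> Zs i \<in> measurable M (borel \<Otimes>\<^sub>M borel)"
  using indep by (auto simp: indep_vars_def)

lemma Xs_measurable: "1 \<le> i \<Longrightarrow> Xs i \<in> borel_measurable M"
  using measurable_compose[OF Zs_measurable measurable_fst, of i] by simp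

lemma label_measurable [measurable (raw)]:
  assumes "g \<in> borel_measurable N" "h \<in> borel_measurable N"
  shows "(\<lambda>z. f (g z) (h z)) \<in> measurable N (count_space UNIV)"
  using measurable_compose[OF measurable_Pair[OF assms] f] by simp

lemma R_measurable [measurable]: "R m \<in> borel_measurable borel"
proof -
  have "(\<lambda>z. of_bool (f (fst z) (snd z) = m) :: real) \<in> borel_measurable (borel \<Otimes>\<^sub>M borel)"
    by measurable
  then have "(\<lambda>(x, u). of_bool (f x u = m) :: real) \<in> borel_measurable (borel \<Otimes>\<^sub>M \<Lambda>)"
    by (simp add: split_beta' measurable_cong_sets[OF sets_pair_measure_cong[OF refl sets_\<Lambda>] refl])
  then show ?thesis
    unfolding R_def[abs_def] by (rule PU.borel_measurable_lebesgue_integral)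
qed

lemma R_nonneg: "0 \<le> R m x"
  unfolding R_def by (intro integral_nonneg_AE) auto

lemma section_integrable: "integrable \<Lambda> (\<lambda>u. of_bool (f x u = m) :: real)"
  by (rule integrable_abs_le_const[OF \<Lambda>, where C=1]) auto

lemma R_le_1: "R m x \<le> 1"
  unfolding R_def by (intro PU.integral_le_const section_integrable) auto

lemma R_abs: "\<bar>R m x\<bar> \<le> 1"
  using R_nonneg[of m x] R_le_1[of m x] by simp

lemma distr_sample:
  assumes "1 \<le> n"
  shows "distr M (Pi\<^sub>M {1..n} (\<lambda>_. borel \<Otimes>\<^sub>M borel)) (\<lambda>\<omega>. \<lambda>i\<in>{1..n}. Zs i \<omega>) = D n"
proof -
  have "indep_vars (\<lambda>_. borel \<Otimes>\<^sub>M borel) Zs {1..n}" by (rule indep_vars_subset[OF indep]) auto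
  then have "distr M (Pi\<^sub>M {1..n} (\<lambda>_. borel \<Otimes>\<^sub>M borel)) (\<lambda>\<omega>. \<lambda>i\<in>{1..n}. Zs i \<omega>) =
      Pi\<^sub>M {1..n} (\<lambda>i. distr M (borel \<Otimes>\<^sub>M borel) (Zs i))"
    using assms Zs_measurable by (subst (asm) indep_vars_iff_distr_eq_PiM') auto
  also have "\<dots> = D n" by (intro PiM_cong) (simp_all add: distr)
  finally show ?thesis .
qed

lemma sets_D: "sets (D n) = sets (Pi\<^sub>M {1..n} (\<lambda>_. borel \<Otimes>\<^sub>M borel))"
  by (intro sets_PiM_cong sets_P\<Lambda>) simp

lemma sample_measurable: "(\<lambda>\<omega>. \<lambda>i\<in>{1..n}. Zs i \<omega>) \<in> measurable M (D n)"
  unfolding measurable_cong_sets[OF refl sets_D]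
  by (intro measurable_restrict Zs_measurable) simp

lemma distr_sample_D:
  assumes "1 \<le> n"
  shows "distr M (D n) (\<lambda>\<omega>. \<lambda>i\<in>{1..n}. Zs i \<omega>) = D n"
  using distr_sample[OF assms] unfolding distr_cong[OF refl sets_D refl] .

lemma coord_measurable: "i \<in> {1..n} \<Longrightarrow> (\<lambda>z. z i) \<in> measurable (D n) (borel \<Otimes>\<^sub>M borel)"
  unfolding measurable_cong_sets[OF sets_D refl] by (rule measurable_component_singleton)

lemma fst_coord_measurable: "i \<in> {1..n} \<Longrightarrow> (\<lambda>z. fst (z i)) \<in> borel_measurable (D n)"
  using measurable_compose[OF coord_measurable measurable_fst] .

lemma snd_coord_measurable: "i \<in> {1..n} \<Longrightarrow> (\<lambda>z. snd (z i)) \<in> borel_measurable (D n)"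
  using measurable_compose[OF coord_measurable measurable_snd] .

lemma coord_label_measurable:
  "i \<in> {1..n} \<Longrightarrow> (\<lambda>z. f (fst (z i)) (snd (z i))) \<in> measurable (D n) (count_space UNIV)"
  by (intro label_measurable fst_coord_measurable snd_coord_measurable)

text \<open>Averaging over the label randomisation of the single observation \<open>j\<close>. The
  weight \<open>w\<close> ignores the second component of coordinate \<open>j\<close>, so Fubini
  integrates that component first and replaces the indicator by its mean \<open>R m\<close>. This
  takes the place of conditioning on all the other variables.\<close>

lemma integral_label:
  fixes w :: "(nat \<Rightarrow> 'a \<times> real) \<Rightarrow> real"
  assumes j: "j \<in> {1..n}" and w [measurable]: "w \<in> borel_measurable (D n)"
    and bdd: "\<And>z. \<bar>w z\<bar> \<le> C"
    and const: "\<And>z x u u'. w (z(j := (x, u))) = w (z(j := (x, u')))"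
  shows "(\<integral>z. w z * of_bool (f (fst (z j)) (snd (z j)) = m) \<partial>D n) = (\<integral>z. w z * R m (fst (z j)) \<partial>D n)"
proof -
  interpret DJ: product_prob_space "\<lambda>_. P \<Otimes>\<^sub>M \<Lambda>" "{1..n} - {j}"
    by (simp add: product_prob_spaceI PXU.prob_space_axioms)
  let ?J = "{1..n} - {j}" and ?D = "Pi\<^sub>M (insert j ({1..n} - {j})) (\<lambda>_. P \<Otimes>\<^sub>M \<Lambda>)"
  have ins: "insert j ?J = {1..n}" using j by auto
  have C: "0 \<le> C" using bdd[of undefined] by linarith
  note [measurable] = fst_coord_measurable[OF j] coord_label_measurable[OF j]
  let ?g = "\<lambda>z. w z * of_bool (f (fst (z j)) (snd (z j)) = m)" and ?h = "\<lambda>z. w z * R m (fst (z j))"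
  have g: "integrable ?D ?g" unfolding ins
    by (rule integrable_abs_le_const[OF prob_D, where C=C], measurable) (use bdd C in \<open>auto simp: of_bool_def\<close>)
  have h: "integrable ?D ?h" unfolding ins
    by (rule integrable_abs_le_const[OF prob_D, where C=C])
      (intro borel_measurable_times w measurable_compose[OF fst_coord_measurable[OF j] R_measurable]
        abs_mult_le_left bdd R_abs)+
  have inner: "(\<integral>s. ?g (y(j := s)) \<partial>(P \<Otimes>\<^sub>M \<Lambda>)) = (\<integral>s. ?h (y(j := s)) \<partial>(P \<Otimes>\<^sub>M \<Lambda>))"
    if y: "y \<in> space (Pi\<^sub>M ?J (\<lambda>_. P \<Otimes>\<^sub>M \<Lambda>))" for y
  proof -
    have "(\<lambda>s. y(j := s)) \<in> measurable (P \<Otimes>\<^sub>M \<Lambda>) ?D"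
      using measurable_compose[OF measurable_Pair1'[OF y] measurable_add_dim[of j ?J "\<lambda>_. P \<Otimes>\<^sub>M \<Lambda>"]] by simp
    then have upd: "(\<lambda>s. y(j := s)) \<in> measurable (P \<Otimes>\<^sub>M \<Lambda>) (D n)" unfolding ins .
    have wm [measurable]: "(\<lambda>s. w (y(j := s))) \<in> borel_measurable (P \<Otimes>\<^sub>M \<Lambda>)"
      using measurable_compose[OF upd w] .
    have ig: "integrable (P \<Otimes>\<^sub>M \<Lambda>) (\<lambda>s. w (y(j := s)) * of_bool (f (fst s) (snd s) = m))"
      by (rule integrable_abs_le_const[OF PXU.prob_space_axioms, where C=C], measurable) (use bdd C in \<open>auto simp: of_bool_def\<close>)
    have ih: "integrable (P \<Otimes>\<^sub>M \<Lambda>) (\<lambda>s. w (y(j := s)) * R m (fst s))"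
      by (rule integrable_abs_le_const[OF PXU.prob_space_axioms, where C=C], measurable)
        (intro abs_mult_le_left bdd R_abs)
    \<comment> \<open>The 0 is an arbitrary value of the second component, on which \<open>w\<close>
      does not depend.\<close>
    define v where "v x = w (y(j := (x, 0)))" for x
    have v: "w (y(j := (x, u))) = v x" for x u
      unfolding v_def by (rule const)
    have "(\<integral>s. ?g (y(j := s)) \<partial>(P \<Otimes>\<^sub>M \<Lambda>)) = (\<integral>s. w (y(j := s)) * of_bool (f (fst s) (snd s) = m) \<partial>(P \<Otimes>\<^sub>M \<Lambda>))"
      by simp
    also have "\<dots> = (\<integral>x. \<integral>u. w (y(j := (x, u))) * of_bool (f x u = m) \<partial>\<Lambda> \<partial>P)"
      using PXU.integral_fst'[OF ig] by simp
    also have "\<dots> = (\<integral>x. v x * R m x \<partial>P)"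
      by (simp add: R_def v)
    also have "\<dots> = (\<integral>x. \<integral>u. w (y(j := (x, u))) * R m x \<partial>\<Lambda> \<partial>P)"
      by (simp add: v PU.prob_space[unfolded space_\<Lambda>])
    also have "\<dots> = (\<integral>s. w (y(j := s)) * R m (fst s) \<partial>(P \<Otimes>\<^sub>M \<Lambda>))"
      using PXU.integral_fst'[OF ih] by simp
    also have "\<dots> = (\<integral>s. ?h (y(j := s)) \<partial>(P \<Otimes>\<^sub>M \<Lambda>))" by simp
    finally show ?thesis .
  qed
  have "(\<integral>z. ?g z \<partial>?D) = (\<integral>y. \<integral>s. ?g (y(j := s)) \<partial>(P \<Otimes>\<^sub>M \<Lambda>) \<partial>Pi\<^sub>M ?J (\<lambda>_. P \<Otimes>\<^sub>M \<Lambda>))"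
    by (rule DJ.product_integral_insert) (use g in auto)
  also have "\<dots> = (\<integral>y. \<integral>s. ?h (y(j := s)) \<partial>(P \<Otimes>\<^sub>M \<Lambda>) \<partial>Pi\<^sub>M ?J (\<lambda>_. P \<Otimes>\<^sub>M \<Lambda>))"
    by (rule Bochner_Integration.integral_cong[OF refl inner])
  also have "\<dots> = (\<integral>z. ?h z \<partial>?D)"
    by (rule DJ.product_integral_insert[symmetric]) (use h in auto)
  finally show ?thesis unfolding ins .
qed

abbreviation nnD :: "nat \<Rightarrow> (nat \<Rightarrow> 'a \<times> real) \<Rightarrow> nat \<Rightarrow> nat" where
  "nnD n z \<equiv> nn_index n (\<lambda>i. fst (z i))"

abbreviation labD :: "(nat \<Rightarrow> 'a \<times> real) \<Rightarrow> nat \<Rightarrow> nat" where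
  "labD z i \<equiv> f (fst (z i)) (snd (z i))"

lemma nnD_measurable: "i \<in> {1..n} \<Longrightarrow> (\<lambda>z. nnD n z i) \<in> measurable (D n) (count_space UNIV)"
  by (intro measurable_nn_index fst_coord_measurable)

lemma labD_nnD_measurable:
  "2 \<le> n \<Longrightarrow> i \<in> {1..n} \<Longrightarrow> (\<lambda>z. labD z (nnD n z i)) \<in> measurable (D n) (count_space UNIV)"
  by (rule measurable_label_nn[where F="\<lambda>j z. labD z j", OF fst_coord_measurable coord_label_measurable])

text \<open>The integral is split according to the value \<open>j\<close> of the neighbour index.
  That index depends on the covariates alone, so for fixed \<open>j\<close> the labels at
  \<open>j\<close> and at 1 can be averaged one after the other. Their randomisations are distinct
  because a point is never its own neighbour.\<close>

lemma integral_pair_labels: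
  assumes n: "2 \<le> n"
  shows "(\<integral>z. of_bool (labD z 1 = k \<and> labD z (nnD n z 1) = l) \<partial>D n) =
    (\<integral>z. R k (fst (z 1)) * R l (fst (z (nnD n z 1))) \<partial>D n)"
proof -
  let ?I = "\<lambda>z j. of_bool (nnD n z 1 = j) :: real"
  have one: "1 \<in> {1..n}" using n by simp
  note [measurable] = nnD_measurable[OF one] coord_label_measurable[OF one] fst_coord_measurable[OF one]
  have nn: "nnD n z 1 \<in> {2..n}" for z using nn_index_mem[OF n, of "\<lambda>i. fst (z i)" 1] by auto
  have upd: "nnD n (z(j := (x, u))) 1 = nnD n (z(j := (x, u'))) 1" for z j x u u'
    by (intro arg_cong[where f="\<lambda>x. nn_index n x 1"]) auto
  have "(\<integral>z. of_bool (labD z 1 = k \<and> labD z (nnD n z 1) = l) \<partial>D n) =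
      (\<integral>z. (\<Sum>j\<in>{2..n}. ?I z j * of_bool (labD z 1 = k) * of_bool (labD z j = l)) \<partial>D n)"
  proof (rule Bochner_Integration.integral_cong[OF refl])
    fix z
    have "(\<Sum>j\<in>{2..n}. ?I z j * of_bool (labD z 1 = k) * of_bool (labD z j = l) :: real) =
        (\<Sum>j\<in>{2..n}. if nnD n z 1 = j then of_bool (labD z 1 = k) * of_bool (labD z j = l) else 0)"
      by (intro sum.cong) auto
    then show "of_bool (labD z 1 = k \<and> labD z (nnD n z 1) = l) =
        (\<Sum>j\<in>{2..n}. ?I z j * of_bool (labD z 1 = k) * of_bool (labD z j = l) :: real)"
      using nn[of z] by (simp add: of_bool_conj)
  qed
  also have "\<dots> = (\<Sum>j\<in>{2..n}. \<integral>z. ?I z j * of_bool (labD z 1 = k) * of_bool (labD z j = l) \<partial>D n)"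
  proof (rule Bochner_Integration.integral_sum)
    fix j assume "j \<in> {2..n}"
    then have j: "j \<in> {1..n}" by auto
    note [measurable] = coord_label_measurable[OF j]
    show "integrable (D n) (\<lambda>z. ?I z j * of_bool (labD z 1 = k) * of_bool (labD z j = l))"
    proof (rule integrable_abs_le_const[OF prob_D, where C=1])
      show "(\<lambda>z. ?I z j * of_bool (labD z 1 = k) * of_bool (labD z j = l)) \<in> borel_measurable (D n)"
        by measurable
    qed (simp add: of_bool_def)
  qed
  also have "\<dots> = (\<Sum>j\<in>{2..n}. \<integral>z. ?I z j * R k (fst (z 1)) * R l (fst (z j)) \<partial>D n)"
  proof (rule sum.cong[OF refl])
    fix j assume j2: "j \<in> {2..n}"
    then have j: "j \<in> {1..n}" "j \<noteq> 1" by auto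
    note [measurable] = coord_label_measurable[OF j(1)] fst_coord_measurable[OF j(1)]
    have "(\<integral>z. ?I z j * of_bool (labD z 1 = k) * of_bool (labD z j = l) \<partial>D n) =
        (\<integral>z. ?I z j * of_bool (labD z 1 = k) * R l (fst (z j)) \<partial>D n)"
    proof (rule integral_label[OF j(1), where C=1])
      show "(\<lambda>z. ?I z j * of_bool (labD z 1 = k)) \<in> borel_measurable (D n)" by measurable
      show "?I (z(j := (x, u))) j * of_bool (labD (z(j := (x, u))) 1 = k) =
          ?I (z(j := (x, u'))) j * of_bool (labD (z(j := (x, u'))) 1 = k)" for z x u u'
        unfolding upd[of z j x u u'] using j(2) by simp
    qed (simp add: of_bool_def)
    also have "\<dots> = (\<integral>z. ?I z j * R l (fst (z j)) * of_bool (labD z 1 = k) \<partial>D n)"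
      by (simp add: mult_ac)
    also have "\<dots> = (\<integral>z. ?I z j * R l (fst (z j)) * R k (fst (z 1)) \<partial>D n)"
    proof (rule integral_label[OF one, where C=1])
      show "\<bar>?I z j * R l (fst (z j))\<bar> \<le> 1" for z using R_abs[of l "fst (z j)"] by (auto simp: of_bool_def)
      show "?I (z(1 := (x, u))) j * R l (fst ((z(1 := (x, u))) j)) =
          ?I (z(1 := (x, u'))) j * R l (fst ((z(1 := (x, u'))) j))" for z x u u'
        unfolding upd[of z 1 x u u'] using j(2) by simp
      show "(\<lambda>z. ?I z j * R l (fst (z j))) \<in> borel_measurable (D n)" by measurable
    qed
    also have "\<dots> = (\<integral>z. ?I z j * R k (fst (z 1)) * R l (fst (z j)) \<partial>D n)" by (simp add: mult_ac)
    finally show "(\<integral>z. ?I z j * of_bool (labD z 1 = k) * of_bool (labD z j = l) \<partial>D n) =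
      (\<integral>z. ?I z j * R k (fst (z 1)) * R l (fst (z j)) \<partial>D n)" .
  qed
  also have "\<dots> = (\<integral>z. (\<Sum>j\<in>{2..n}. ?I z j * R k (fst (z 1)) * R l (fst (z j))) \<partial>D n)"
  proof (rule Bochner_Integration.integral_sum[symmetric])
    fix j assume "j \<in> {2..n}"
    then have j: "j \<in> {1..n}" by auto
    note [measurable] = fst_coord_measurable[OF j]
    show "integrable (D n) (\<lambda>z. ?I z j * R k (fst (z 1)) * R l (fst (z j)))"
    proof (rule integrable_abs_le_const[OF prob_D, where C=1])
      show "(\<lambda>z. ?I z j * R k (fst (z 1)) * R l (fst (z j))) \<in> borel_measurable (D n)"
        by measurable
    qed (intro abs_mult_le_left R_abs; simp)
  qed
  also have "\<dots> = (\<integral>z. R k (fst (z 1)) * R l (fst (z (nnD n z 1))) \<partial>D n)"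
  proof (rule Bochner_Integration.integral_cong[OF refl])
    fix z
    have "(\<Sum>j\<in>{2..n}. ?I z j * R k (fst (z 1)) * R l (fst (z j))) =
        (\<Sum>j\<in>{2..n}. if nnD n z 1 = j then R k (fst (z 1)) * R l (fst (z j)) else 0)"
      by (intro sum.cong) auto
    then show "(\<Sum>j\<in>{2..n}. ?I z j * R k (fst (z 1)) * R l (fst (z j))) =
        R k (fst (z 1)) * R l (fst (z (nnD n z 1)))"
      using nn[of z] by simp
  qed
  finally show ?thesis .
qed

text \<open>The i.i.d. law \<open>D n\<close> is invariant under permutations of the coordinates,
  and nearest neighbours commute with a relabelling that keeps the order of the points other than
  the first.\<close>

lemma integral_exchange:
  assumes n: "2 \<le> n" and i: "i \<in> {1..n}"
  shows "(\<integral>z. of_bool (labD z i = k \<and> labD z (nnD n z i) = l) \<partial>D n) =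
    (\<integral>z. of_bool (labD z 1 = k \<and> labD z (nnD n z 1) = l) \<partial>D n :: real)"
proof -
  \<comment> \<open>A cycle: 1 goes to \<open>i\<close> and 2, ..., i move down by one, so
    \<open>\<sigma>\<close> is increasing on \<open>{2..n}\<close>. Swapping 1 and \<open>i\<close>
    would in general disturb the order by which ties are broken.\<close>
  define \<sigma> where "\<sigma> j = (if j = 1 then i else if j \<le> i then j - 1 else j)" for j :: nat
  have one: "1 \<in> {1..n}" using n by simp
  have inj: "inj_on \<sigma> {1..n}" using i by (auto simp: inj_on_def \<sigma>_def split: if_splits)
  have into: "\<sigma> \<in> {1..n} \<rightarrow> {1..n}" using i by (auto simp: \<sigma>_def)
  then have bij: "bij_betw \<sigma> {1..n} {1..n}"
    using inj by (simp add: bij_betw_def endo_inj_surj image_subset_iff_funcset)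
  have mono: "strict_mono_on ({1..n} - {1}) \<sigma>"
    by (auto simp: strict_mono_on_def \<sigma>_def)
  let ?t = "\<lambda>z :: nat \<Rightarrow> 'a \<times> real. \<lambda>j\<in>{1..n}. z (\<sigma> j)"
  let ?F = "\<lambda>z. of_bool (labD z 1 = k \<and> labD z (nnD n z 1) = l) :: real"
  have F: "?F \<in> borel_measurable (D n)"
    using coord_label_measurable[OF one] labD_nnD_measurable[OF n one] by measurable
  have t: "?t \<in> measurable (D n) (D n)"
    using into by (intro measurable_restrict measurable_component_singleton) auto
  have "distr (D n) (D n) ?t = D n"
    using distr_PiM_reindex[where K="{1..n}" and I="{1..n}" and f=\<sigma> and M="\<lambda>_. P \<Otimes>\<^sub>M \<Lambda>"] inj into
      PXU.prob_space_axioms by simp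
  then have "(\<integral>z. ?F z \<partial>D n) = (\<integral>z. ?F z \<partial>distr (D n) (D n) ?t)" by simp
  also have "\<dots> = (\<integral>z. ?F (?t z) \<partial>D n)" by (rule integral_distr[OF t F])
  also have "\<dots> = (\<integral>z. of_bool (labD z i = k \<and> labD z (nnD n z i) = l) \<partial>D n)"
  proof (rule Bochner_Integration.integral_cong[OF refl])
    fix z
    have "nnD n (?t z) 1 = nn_index n (\<lambda>j. fst (z (\<sigma> j))) 1"
      by (rule nn_index_cong[OF _ one]) simp
    moreover have "nnD n z (\<sigma> 1) = \<sigma> (nn_index n (\<lambda>j. fst (z (\<sigma> j))) 1)"
      by (rule nn_index_reindex[OF n one bij mono])
    moreover have "\<sigma> 1 = i" by (simp add: \<sigma>_def)
    moreover have "nn_index n (\<lambda>j. fst (z (\<sigma> j))) 1 \<in> {1..n}"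
      using nn_index_mem[OF n, of "\<lambda>j. fst (z (\<sigma> j))" 1] by simp
    ultimately have "?t z 1 = z i" "?t z (nnD n (?t z) 1) = z (nnD n z i)"
      using one by simp_all
    then show "?F (?t z) = of_bool (labD z i = k \<and> labD z (nnD n z i) = l)" by simp
  qed
  finally show ?thesis by simp
qed

abbreviation G :: "nat \<Rightarrow> nat \<Rightarrow> nat \<Rightarrow> (nat \<Rightarrow> 'a \<times> real) \<Rightarrow> real" where
  "G n k l z \<equiv> p2_hat n (labD z) (nnD n z) k l"

lemma G_measurable: "2 \<le> n \<Longrightarrow> G n k l \<in> borel_measurable (D n)"
  by (rule measurable_p2_hat[where Y="\<lambda>i z. labD z i", OF fst_coord_measurable coord_label_measurable])

lemma integral_G:
  assumes n: "2 \<le> n"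
  shows "(\<integral>z. G n k l z \<partial>D n) = (\<integral>z. R k (fst (z 1)) * R l (fst (z (nnD n z 1))) \<partial>D n)"
proof -
  let ?F = "\<lambda>i z. of_bool (labD z i = k \<and> labD z (nnD n z i) = l) :: real"
  have int: "integrable (D n) (?F i)" if "i \<in> {1..n}" for i
  proof (rule integrable_abs_le_const[OF prob_D, where C=1])
    show "?F i \<in> borel_measurable (D n)"
      using coord_label_measurable[OF that] labD_nnD_measurable[OF n that] by measurable
  qed simp
  have "(\<integral>z. G n k l z \<partial>D n) = 1 / real n * (\<Sum>i=1..n. \<integral>z. ?F i z \<partial>D n)"
    unfolding p2_hat_def integral_mult_right_zero
    by (intro arg_cong2[where f="(*)"] refl Bochner_Integration.integral_sum int)
  also have "\<dots> = 1 / real n * (\<Sum>i=1..n. \<integral>z. ?F 1 z \<partial>D n)"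
    by (intro arg_cong2[where f="(*)"] refl sum.cong integral_exchange n)
  also have "\<dots> = (\<integral>z. ?F 1 z \<partial>D n)" using n by simp
  also have "\<dots> = (\<integral>z. R k (fst (z 1)) * R l (fst (z (nnD n z 1))) \<partial>D n)" by (rule integral_pair_labels[OF n])
  finally show ?thesis .
qed

end

section \<open>Strong consistency\<close>

lemma measurable_of_bool_neq:
  fixes g g' :: "'b \<Rightarrow> nat"
  assumes [measurable]: "g \<in> measurable N (count_space UNIV)" "g' \<in> measurable N (count_space UNIV)"
  shows "(\<lambda>z. of_bool (g z \<noteq> g' z) :: real) \<in> borel_measurable N"
proof -
  have "(\<lambda>z. if real (g z) = real (g' z) then 0 else 1 :: real) \<in> borel_measurable N" by measurable
  moreover have "of_bool (g z \<noteq> g' z) = (if real (g z) = real (g' z) then 0 else 1 :: real)" for z by simp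
  ultimately show ?thesis by simp
qed

section \<open>Transfer from the product space to the sample, and almost sure concentration around
  the mean\<close>

context nn_sample
begin

abbreviation lab :: "nat \<Rightarrow> 'w \<Rightarrow> nat" where "lab i \<omega> \<equiv> f (Xs i \<omega>) (Us i \<omega>)"

abbreviation nn :: "nat \<Rightarrow> 'w \<Rightarrow> nat \<Rightarrow> nat" where "nn n \<omega> \<equiv> nn_index n (\<lambda>i. Xs i \<omega>)"

abbreviation XN :: "nat \<Rightarrow> 'w \<Rightarrow> 'a" where "XN n \<omega> \<equiv> Xs (nn n \<omega> 1) \<omega>"

definition phat :: "nat \<Rightarrow> nat \<Rightarrow> nat \<Rightarrow> 'w \<Rightarrow> real" where
  "phat n k l \<omega> = p2_hat n (\<lambda>i. lab i \<omega>) (nn n \<omega>) k l"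

lemma XN_measurable: "2 \<le> n \<Longrightarrow> XN n \<in> borel_measurable M"
  by (rule measurable_label_nn[where F=Xs]) (auto intro: Xs_measurable)

lemma nnD_sample: "i \<in> {1..n} \<Longrightarrow> nnD n (\<lambda>i\<in>{1..n}. Zs i \<omega>) i = nn n \<omega> i"
  by (rule nn_index_cong) simp_all

lemma G_sample:
  assumes "2 \<le> n"
  shows "G n k l (\<lambda>i\<in>{1..n}. Zs i \<omega>) = phat n k l \<omega>"
proof -
  have "nn n \<omega> i \<in> {1..n}" for i using nn_index_mem[OF assms, of "\<lambda>i. Xs i \<omega>" i] by simp
  then show ?thesis
    unfolding phat_def p2_hat_def by (intro arg_cong2[where f="(*)"] refl sum.cong)
      (simp only: nnD_sample restrict_apply' fst_conv snd_conv)
qed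

lemma max_indegree_sample:
  "max_indegree n (\<lambda>i. fst ((\<lambda>i\<in>{1..n}. Zs i \<omega>) i)) = max_indegree n (\<lambda>i. Xs i \<omega>)"
  by (rule max_indegree_cong) simp

lemma phat_measurable: "2 \<le> n \<Longrightarrow> phat n k l \<in> borel_measurable M"
  using measurable_compose[OF sample_measurable G_measurable, of n k l] by (simp only: G_sample)

lemma integral_D:
  fixes g :: "(nat \<Rightarrow> 'a \<times> real) \<Rightarrow> real"
  assumes n: "1 \<le> n" and g: "g \<in> borel_measurable (D n)"
  shows "(\<integral>z. g z \<partial>D n) = (\<integral>\<omega>. g (\<lambda>i\<in>{1..n}. Zs i \<omega>) \<partial>M)"
  using integral_distr[OF sample_measurable g] unfolding distr_sample_D[OF n] by simp

lemma prob_D_eq: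
  assumes n: "1 \<le> n" and g: "Measurable.pred (D n) Q"
  shows "measure (D n) {z \<in> space (D n). Q z} = prob {\<omega> \<in> space M. Q (\<lambda>i\<in>{1..n}. Zs i \<omega>)}"
proof -
  have "measure (D n) {z \<in> space (D n). Q z} = measure (distr M (D n) (\<lambda>\<omega>. \<lambda>i\<in>{1..n}. Zs i \<omega>)) {z \<in> space (D n). Q z}"
    by (simp only: distr_sample_D[OF n])
  also have "\<dots> = prob ((\<lambda>\<omega>. \<lambda>i\<in>{1..n}. Zs i \<omega>) -` {z \<in> space (D n). Q z} \<inter> space M)"
    using g by (intro measure_distr sample_measurable) simp
  also have "(\<lambda>\<omega>. \<lambda>i\<in>{1..n}. Zs i \<omega>) -` {z \<in> space (D n). Q z} \<inter> space M = {\<omega> \<in> space M. Q (\<lambda>i\<in>{1..n}. Zs i \<omega>)}"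
    using measurable_space[OF sample_measurable] by blast
  finally show ?thesis .
qed

lemma expectation_phat:
  assumes n: "2 \<le> n"
  shows "(\<integral>\<omega>. phat n k l \<omega> \<partial>M) = (\<integral>\<omega>. R k (Xs 1 \<omega>) * R l (XN n \<omega>) \<partial>M)"
proof -
  have one: "1 \<in> {1..n}" and n1: "1 \<le> n" using n by auto
  have m: "(\<lambda>z. R k (fst (z 1)) * R l (fst (z (nnD n z 1)))) \<in> borel_measurable (D n)"
    by (intro borel_measurable_times measurable_compose[OF _ R_measurable] fst_coord_measurable[OF one]
      measurable_label_nn[where F="\<lambda>j z. fst (z j)", OF fst_coord_measurable fst_coord_measurable n one])
  have nn: "nn n \<omega> 1 \<in> {1..n}" for \<omega> using nn_index_mem[OF n, of "\<lambda>i. Xs i \<omega>" 1] by simp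
  have "(\<integral>\<omega>. phat n k l \<omega> \<partial>M) = (\<integral>z. G n k l z \<partial>D n)"
    using integral_D[OF n1 G_measurable[OF n], of k l] by (simp only: G_sample[OF n])
  also note integral_G[OF n]
  also have "(\<integral>z. R k (fst (z 1)) * R l (fst (z (nnD n z 1))) \<partial>D n) = (\<integral>\<omega>. R k (Xs 1 \<omega>) * R l (XN n \<omega>) \<partial>M)"
    unfolding integral_D[OF n1 m] using one nn by (simp only: nnD_sample[OF one] restrict_apply' fst_conv)
  finally show ?thesis .
qed

text \<open>The good samples are those with maximal in-degree below \<open>c\<close>; between them
  the estimate is Lipschitz in the Hamming distance with constant \<open>(1 + 2 * c) / n\<close>.
  The mean is the unrestricted one. Both the estimate and the in-degree depend only on the first
  \<open>n\<close> observations, so the bound carries over from \<open>D n\<close>.\<close>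

lemma phat_tail:
  fixes c :: real
  assumes n: "2 \<le> n" and c: "0 \<le> c" and \<epsilon>: "0 < \<epsilon>"
    and bad: "prob {\<omega> \<in> space M. c \<le> max_indegree n (\<lambda>i. Xs i \<omega>)} \<le> \<epsilon> / (2 * (2 + \<epsilon>))"
  shows "prob {\<omega> \<in> space M. \<epsilon> \<le> \<bar>phat n k l \<omega> - expectation (phat n k l)\<bar>} \<le>
      2 * prob {\<omega> \<in> space M. c \<le> max_indegree n (\<lambda>i. Xs i \<omega>)} +
      4 * (2 + \<epsilon>) / \<epsilon> * exp (- \<epsilon>\<^sup>2 / (4 * ((1 + 2 * c) / n)\<^sup>2 * n))"
proof -
  have n1: "1 \<le> n" using n by simp
  let ?L = "\<lambda>z :: nat \<Rightarrow> 'a \<times> real. max_indegree n (\<lambda>i. fst (z i))"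
  have L: "Measurable.pred (D n) (\<lambda>z. c \<le> ?L z)"
    by (intro measurable_max_indegree fst_coord_measurable n1)
  then have L': "Measurable.pred (D n) (\<lambda>z. \<not> c \<le> ?L z)" by simp
  note [measurable] = G_measurable[OF n, of k l]
  have E: "(\<integral>z. G n k l z \<partial>D n) = expectation (phat n k l)"
    using integral_D[OF n1 G_measurable[OF n], of k l] by (simp only: G_sample[OF n])
  have 1: "measure (D n) {z \<in> space (D n). \<not> \<not> c \<le> ?L z} = prob {\<omega> \<in> space M. c \<le> max_indegree n (\<lambda>i. Xs i \<omega>)}"
    unfolding not_not prob_D_eq[OF n1 L] max_indegree_sample ..
  have m: "Measurable.pred (D n) (\<lambda>z. \<epsilon> \<le> \<bar>G n k l z - expectation (phat n k l)\<bar>)" by measurable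
  have 2: "measure (D n) {z \<in> space (D n). \<epsilon> \<le> \<bar>G n k l z - (\<integral>z. G n k l z \<partial>D n)\<bar>} =
      prob {\<omega> \<in> space M. \<epsilon> \<le> \<bar>phat n k l \<omega> - expectation (phat n k l)\<bar>}"
    unfolding E prob_D_eq[OF n1 m] G_sample[OF n] ..
  have "measure (D n) {z \<in> space (D n). \<epsilon> \<le> \<bar>G n k l z - (\<integral>z. G n k l z \<partial>D n)\<bar>} \<le>
      2 * measure (D n) {z \<in> space (D n). \<not> \<not> c \<le> ?L z} +
      4 * (2 + \<epsilon>) / \<epsilon> * exp (- \<epsilon>\<^sup>2 / (4 * ((1 + 2 * c) / n)\<^sup>2 * real (card {1..n})))"
  proof (rule product_two_sided_tail)
    fix z z' :: "nat \<Rightarrow> 'a \<times> real" assume z: "\<not> c \<le> ?L z" "\<not> c \<le> ?L z'"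
    show "G n k l z - G n k l z' \<le> (1 + 2 * c) / n * hamming {1..n} z z'"
      by (rule p2_hat_lipschitz[OF n]) (use z in auto)
  qed (use n c \<epsilon> bad 1 L' G_measurable[OF n, of k l] in \<open>auto simp: PXU.prob_space_axioms p2_hat_nonneg p2_hat_le_1\<close>)
  then show ?thesis unfolding 1 2 by simp
qed

text \<open>Borel-Cantelli for each fixed \<open>\<epsilon>\<close>, followed by an intersection
  over the countably many values 1/(m+1).\<close>

lemma phat_minus_expectation_tendsto:
  fixes kn :: "nat \<Rightarrow> real"
  assumes summ: "summable (\<lambda>n. prob {\<omega> \<in> space M. kn n \<le> max_indegree n (\<lambda>i. Xs i \<omega>)})"
    and small: "kn \<in> o(\<lambda>n. sqrt (real n / ln (real n)))"
  shows "AE \<omega> in M. (\<lambda>n. phat n k l \<omega> - expectation (phat n k l)) \<longlonglongrightarrow> 0"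
proof -
  let ?b = "\<lambda>n. prob {\<omega> \<in> space M. kn n \<le> max_indegree n (\<lambda>i. Xs i \<omega>)}"
  have b0: "?b \<longlonglongrightarrow> 0" by (rule summable_LIMSEQ_zero[OF summ])
  \<comment> \<open>For negative \<open>kn n\<close> the event would be the whole space, which is
    impossible once its probability is below 1. Nonnegativity is what the tail bound asks of its
    threshold.\<close>
  have pos: "eventually (\<lambda>n. 0 \<le> kn n) sequentially"
    using order_tendstoD(2)[OF b0, of 1, simplified]
  proof eventually_elim
    case (elim n)
    show ?case
    proof (rule ccontr)
      assume "\<not> 0 \<le> kn n"
      then have "{\<omega> \<in> space M. kn n \<le> max_indegree n (\<lambda>i. Xs i \<omega>)} = space M"
        by (auto intro: order_trans[of "kn n" 0])
      then show False using elim by (simp add: prob_space)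
    qed
  qed
  have ev: "AE \<omega> in M. eventually (\<lambda>n. \<bar>phat n k l \<omega> - expectation (phat n k l)\<bar> < \<epsilon>) sequentially"
    if \<epsilon>: "0 < \<epsilon>" for \<epsilon>
  proof -
    \<comment> \<open>The event is set to be empty for \<open>n < 2\<close>, where no neighbour
      exists.\<close>
    define A where "A n = (if 2 \<le> n then {\<omega> \<in> space M. \<epsilon> \<le> \<bar>phat n k l \<omega> - expectation (phat n k l)\<bar>} else {})" for n
    have A: "A n \<in> sets M" for n
    proof (cases "2 \<le> n")
      case True
      note [measurable] = phat_measurable[OF True]
      show ?thesis using True unfolding A_def by simp
    qed (simp add: A_def)
    have "summable (\<lambda>n. 2 * ?b n + 4 * (2 + \<epsilon>) / \<epsilon> * exp (- \<epsilon>\<^sup>2 / (4 * ((1 + 2 * kn n) / n)\<^sup>2 * real n)))"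
      by (intro summable_add summable_mult summ summable_exp_tail[OF small \<epsilon> pos])
    then have "summable (\<lambda>n. prob (A n))"
    proof (rule summable_comparison_test_ev[rotated])
      \<comment> \<open>The tail bound presupposes that large in-degrees are unlikely compared with
        \<open>\<epsilon>\<close>; as their probabilities tend to 0, this holds from some
        \<open>n\<close> on.\<close>
      have "eventually (\<lambda>n. ?b n < \<epsilon> / (2 * (2 + \<epsilon>))) sequentially"
        by (rule order_tendstoD(2)[OF b0]) (use \<epsilon> in simp)
      then show "\<forall>\<^sub>F n in sequentially. norm (prob (A n)) \<le>
          2 * ?b n + 4 * (2 + \<epsilon>) / \<epsilon> * exp (- \<epsilon>\<^sup>2 / (4 * ((1 + 2 * kn n) / n)\<^sup>2 * real n))"
        using pos eventually_ge_at_top[of 2]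
      proof eventually_elim
        case (elim n)
        show ?case using phat_tail[OF elim(3,2) \<epsilon>, of k l] elim(1,3) by (simp add: A_def)
      qed
    qed
    then have "AE \<omega> in M. eventually (\<lambda>n. \<omega> \<in> space M - A n) sequentially"
      by (intro borel_cantelli_AE1 A) (simp_all add: emeasure_eq_measure)
    then show ?thesis
    proof eventually_elim
      case (elim \<omega>)
      from elim eventually_ge_at_top[of 2] show ?case
        by eventually_elim (auto simp: A_def)
    qed
  qed
  have "AE \<omega> in M. \<forall>m::nat. eventually (\<lambda>n. \<bar>phat n k l \<omega> - expectation (phat n k l)\<bar> < 1 / real (Suc m)) sequentially"
    unfolding AE_all_countable by (intro allI ev) simp
  then show ?thesis
  proof eventually_elim
    case (elim \<omega>)
    show ?case
    proof (rule tendstoI)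
      fix e :: real assume "0 < e"
      then obtain m where m: "1 / real (Suc m) < e" using nat_approx_posE by blast
      show "\<forall>\<^sub>F n in sequentially. dist (phat n k l \<omega> - expectation (phat n k l)) 0 < e"
        using elim[rule_format, of m] by eventually_elim (use m in simp)
    qed
  qed
qed

section \<open>Convergence of the means by way of label disagreement\<close>

lemma distr_Xs: "1 \<le> i \<Longrightarrow> distr M borel (Xs i) = P"
proof -
  assume i: "1 \<le> i"
  have "distr M borel (Xs i) = distr (distr M (borel \<Otimes>\<^sub>M borel) (Zs i)) borel fst"
    by (subst distr_distr[OF measurable_fst Zs_measurable[OF i]]) (simp add: comp_def)
  also have "\<dots> = distr (P \<Otimes>\<^sub>M \<Lambda>) borel fst" by (simp only: distr[OF i])
  also have "\<dots> = distr (P \<Otimes>\<^sub>M \<Lambda>) P fst" by (intro distr_cong) (simp_all add: sets_P)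
  also have "\<dots> = P" by (rule PU.distr_pair_fst)
  finally show ?thesis .
qed

lemma section_measurable: "f x \<in> measurable \<Lambda> (count_space UNIV)"
  using label_measurable[of "\<lambda>_. x" borel "\<lambda>u. u"] unfolding measurable_cong_sets[OF sets_\<Lambda> refl] by simp

text \<open>The indicators of one fixed label can differ only where the labels themselves
  differ.\<close>

lemma R_diff_le: "\<bar>R m x - R m x'\<bar> \<le> (\<integral>u. of_bool (f x u \<noteq> f x' u) \<partial>\<Lambda>)"
proof -
  have int: "integrable \<Lambda> (\<lambda>u. of_bool (f x u \<noteq> f x' u) :: real)"
    by (rule integrable_abs_le_const[OF \<Lambda>, where C=1], intro measurable_of_bool_neq section_measurable) simp
  have "\<bar>R m x - R m x'\<bar> = \<bar>\<integral>u. of_bool (f x u = m) - of_bool (f x' u = m) \<partial>\<Lambda>\<bar>"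
    unfolding R_def using section_integrable by simp
  also have "\<dots> \<le> (\<integral>u. \<bar>of_bool (f x u = m) - of_bool (f x' u = m)\<bar> \<partial>\<Lambda>)"
    by (rule integral_abs_bound)
  also have "\<dots> \<le> (\<integral>u. of_bool (f x u \<noteq> f x' u) \<partial>\<Lambda>)"
    by (intro integral_mono int integrable_abs Bochner_Integration.integrable_diff section_integrable) auto
  finally show ?thesis .
qed

text \<open>The common target of the two alternative conditions: each of them is used to show that
  the mean of this indicator over \<open>M\<close> and \<open>\<Lambda>\<close> tends to 0, and that
  limit alone controls the bias of the estimate.\<close>

definition disagree :: "nat \<Rightarrow> 'w \<Rightarrow> real \<Rightarrow> real" where
  "disagree n \<omega> u = of_bool (f (XN n \<omega>) u \<noteq> f (Xs 1 \<omega>) u)"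

sublocale MU: pair_prob_space M \<Lambda> ..

lemma disagree_measurable:
  assumes "2 \<le> n"
  shows "case_prod (disagree n) \<in> borel_measurable (M \<Otimes>\<^sub>M \<Lambda>)"
proof -
  note [measurable] = XN_measurable[OF assms] Xs_measurable[OF order_refl]
  have "snd \<in> measurable (M \<Otimes>\<^sub>M \<Lambda>) borel"
    using measurable_snd[of M \<Lambda>] unfolding measurable_cong_sets[OF refl sets_\<Lambda>] .
  then have "(\<lambda>z. of_bool (f (XN n (fst z)) (snd z) \<noteq> f (Xs 1 (fst z)) (snd z)) :: real) \<in> borel_measurable (M \<Otimes>\<^sub>M \<Lambda>)"
    by (intro measurable_of_bool_neq label_measurable) measurable
  then show ?thesis by (simp add: disagree_def case_prod_beta')
qed

lemma disagree_bounds: "0 \<le> disagree n \<omega> u" "disagree n \<omega> u \<le> 1" "norm (disagree n \<omega> u) \<le> 1"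
  by (simp_all add: disagree_def)

lemma disagree_section_measurable: "disagree n \<omega> \<in> borel_measurable \<Lambda>"
  unfolding disagree_def[abs_def] by (intro measurable_of_bool_neq section_measurable)

lemma disagree_mean_measurable:
  "2 \<le> n \<Longrightarrow> (\<lambda>\<omega>. \<integral>u. disagree n \<omega> u \<partial>\<Lambda>) \<in> borel_measurable M"
  by (intro PU.borel_measurable_lebesgue_integral disagree_measurable)

lemma disagree_mean_bounds: "0 \<le> (\<integral>u. disagree n \<omega> u \<partial>\<Lambda>)" "(\<integral>u. disagree n \<omega> u \<partial>\<Lambda>) \<le> 1"
proof -
  show "0 \<le> (\<integral>u. disagree n \<omega> u \<partial>\<Lambda>)" using disagree_bounds by (intro integral_nonneg_AE) auto
  have "integrable \<Lambda> (disagree n \<omega>)"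
    by (rule integrable_abs_le_const[OF \<Lambda> disagree_section_measurable, where C=1]) (use disagree_bounds in auto)
  then show "(\<integral>u. disagree n \<omega> u \<partial>\<Lambda>) \<le> 1"
    by (rule PU.integral_le_const) (use disagree_bounds in auto)
qed

lemma expectation_phat_tendsto:
  assumes lim: "(\<lambda>n. \<integral>\<omega>. \<integral>u. disagree n \<omega> u \<partial>\<Lambda> \<partial>M) \<longlonglongrightarrow> 0"
  shows "(\<lambda>n. expectation (phat n k l)) \<longlonglongrightarrow> (\<integral>x. R k x * R l x \<partial>P)"
proof -
  have X1: "Xs 1 \<in> borel_measurable M" by (rule Xs_measurable) simp
  have "(\<integral>x. R k x * R l x \<partial>P) = (\<integral>x. R k x * R l x \<partial>distr M borel (Xs 1))" by (simp add: distr_Xs)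
  also have "\<dots> = (\<integral>\<omega>. R k (Xs 1 \<omega>) * R l (Xs 1 \<omega>) \<partial>M)" by (rule integral_distr[OF X1]) measurable
  finally have eq: "(\<integral>x. R k x * R l x \<partial>P) = (\<integral>\<omega>. R k (Xs 1 \<omega>) * R l (Xs 1 \<omega>) \<partial>M)" .
  have bound: "\<bar>expectation (phat n k l) - (\<integral>x. R k x * R l x \<partial>P)\<bar> \<le> (\<integral>\<omega>. \<integral>u. disagree n \<omega> u \<partial>\<Lambda> \<partial>M)"
    if n: "2 \<le> n" for n
  proof -
    have int: "integrable M (\<lambda>\<omega>. R k (Xs 1 \<omega>) * R l (Z \<omega>))" if Z: "Z \<in> borel_measurable M" for Z
      by (rule integrable_abs_le_const[OF prob_space_axioms, where C=1])
        (intro borel_measurable_times measurable_compose[OF _ R_measurable] X1 Z abs_mult_le_left R_abs)+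
    have intD: "integrable M (\<lambda>\<omega>. \<integral>u. disagree n \<omega> u \<partial>\<Lambda>)"
      by (rule integrable_abs_le_const[OF prob_space_axioms disagree_mean_measurable[OF n], where C=1])
        (use disagree_mean_bounds in \<open>simp add: abs_of_nonneg\<close>)
    have "\<bar>expectation (phat n k l) - (\<integral>x. R k x * R l x \<partial>P)\<bar> =
        \<bar>\<integral>\<omega>. R k (Xs 1 \<omega>) * R l (XN n \<omega>) - R k (Xs 1 \<omega>) * R l (Xs 1 \<omega>) \<partial>M\<bar>"
      unfolding eq expectation_phat[OF n] using int[OF XN_measurable[OF n]] int[OF X1] by simp
    also have "\<dots> \<le> (\<integral>\<omega>. \<bar>R k (Xs 1 \<omega>) * R l (XN n \<omega>) - R k (Xs 1 \<omega>) * R l (Xs 1 \<omega>)\<bar> \<partial>M)"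
      by (rule integral_abs_bound)
    also have "\<dots> \<le> (\<integral>\<omega>. \<integral>u. disagree n \<omega> u \<partial>\<Lambda> \<partial>M)"
    proof (rule integral_mono)
      show "integrable M (\<lambda>\<omega>. \<bar>R k (Xs 1 \<omega>) * R l (XN n \<omega>) - R k (Xs 1 \<omega>) * R l (Xs 1 \<omega>)\<bar>)"
        by (intro integrable_abs Bochner_Integration.integrable_diff int XN_measurable n X1)
      fix \<omega>
      have "\<bar>R k (Xs 1 \<omega>) * R l (XN n \<omega>) - R k (Xs 1 \<omega>) * R l (Xs 1 \<omega>)\<bar> =
          \<bar>(R l (XN n \<omega>) - R l (Xs 1 \<omega>)) * R k (Xs 1 \<omega>)\<bar>" by (simp add: algebra_simps)
      also have "\<dots> \<le> (\<integral>u. disagree n \<omega> u \<partial>\<Lambda>)"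
        unfolding disagree_def by (intro abs_mult_le_left R_abs R_diff_le)
      finally show "\<bar>R k (Xs 1 \<omega>) * R l (XN n \<omega>) - R k (Xs 1 \<omega>) * R l (Xs 1 \<omega>)\<bar> \<le> (\<integral>u. disagree n \<omega> u \<partial>\<Lambda>)" .
    qed (rule intD)
    finally show ?thesis .
  qed
  have "(\<lambda>n. expectation (phat n k l) - (\<integral>x. R k x * R l x \<partial>P)) \<longlonglongrightarrow> 0"
  proof (rule Lim_null_comparison[OF _ lim])
    show "\<forall>\<^sub>F n in sequentially. norm (expectation (phat n k l) - (\<integral>x. R k x * R l x \<partial>P)) \<le>
        (\<integral>\<omega>. \<integral>u. disagree n \<omega> u \<partial>\<Lambda> \<partial>M)"
      using eventually_ge_at_top[of 2] by eventually_elim (simp only: real_norm_def bound)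
  qed
  then show ?thesis by (simp add: LIM_zero_iff)
qed

text \<open>Fubini lets \<open>\<omega>\<close> be integrated first. For fixed \<open>u\<close> this
  gives the probability of disagreement, which tends to 0 for almost every \<open>u\<close> and is
  bounded by 1, so dominated convergence in \<open>u\<close> applies.\<close>

lemma disagree_tendsto_of_in_prob:
  assumes lim: "AE u in \<Lambda>. (\<lambda>n. prob {\<omega> \<in> space M. f (XN n \<omega>) u \<noteq> f (Xs 1 \<omega>) u}) \<longlonglongrightarrow> 0"
  shows "(\<lambda>n. \<integral>\<omega>. \<integral>u. disagree n \<omega> u \<partial>\<Lambda> \<partial>M) \<longlonglongrightarrow> 0"
\<comment> \<open>The shift by 2 keeps the index in the range where a neighbour exists and
  \<open>XN\<close> is measurable.\<close>
proof (rule LIMSEQ_offset[of _ 2])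
  have int: "integrable (M \<Otimes>\<^sub>M \<Lambda>) (case_prod (disagree (n + 2)))" for n
    by (rule integrable_abs_le_const[OF MU.prob_space_axioms disagree_measurable, where C=1])
      (use disagree_bounds in auto)
  have eq: "(\<integral>\<omega>. disagree (n + 2) \<omega> u \<partial>M) = prob {\<omega> \<in> space M. f (XN (n + 2) \<omega>) u \<noteq> f (Xs 1 \<omega>) u}" for n u
  proof -
    have "(\<integral>\<omega>. disagree (n + 2) \<omega> u \<partial>M) =
        (\<integral>\<omega>. indicator {\<omega> \<in> space M. f (XN (n + 2) \<omega>) u \<noteq> f (Xs 1 \<omega>) u} \<omega> \<partial>M)"
      by (intro Bochner_Integration.integral_cong) (auto simp: disagree_def indicator_def)
    then show ?thesis by (simp add: Int_absorb1 Int_absorb2 subset_eq)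
  qed
  have "(\<lambda>n. \<integral>u. \<integral>\<omega>. disagree (n + 2) \<omega> u \<partial>M \<partial>\<Lambda>) \<longlonglongrightarrow> (\<integral>u. 0 \<partial>\<Lambda>)"
  proof (rule integral_dominated_convergence[where w="\<lambda>_. 1"])
    show "(\<lambda>u. \<integral>\<omega>. disagree (n + 2) \<omega> u \<partial>M) \<in> borel_measurable \<Lambda>" for n
      using MU.integrable_snd[OF int] by (rule borel_measurable_integrable)
    show "AE u in \<Lambda>. (\<lambda>n. \<integral>\<omega>. disagree (n + 2) \<omega> u \<partial>M) \<longlonglongrightarrow> 0"
      using lim unfolding eq by eventually_elim (rule LIMSEQ_ignore_initial_segment)
    show "AE u in \<Lambda>. norm (\<integral>\<omega>. disagree (n + 2) \<omega> u \<partial>M) \<le> 1" for n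
      unfolding eq by simp
  qed simp_all
  then show "(\<lambda>n. \<integral>\<omega>. \<integral>u. disagree (n + 2) \<omega> u \<partial>\<Lambda> \<partial>M) \<longlonglongrightarrow> 0"
    using MU.Fubini_integral[OF int] by simp
qed

text \<open>If \<open>b\<close> is a null set of \<open>P\<close>, the first covariate almost surely
  avoids it. Otherwise the later covariates miss \<open>b\<close> independently with the same
  probability below 1, so they cannot all miss it with positive probability. The implication thus
  covers every open set, inside or outside the support of \<open>P\<close>.\<close>

lemma AE_sample_visits_open:
  assumes b: "open b"
  shows "AE \<omega> in M. Xs 1 \<omega> \<in> b \<longrightarrow> (\<exists>j\<ge>2. Xs j \<omega> \<in> b)"
proof (cases "measure P b = 0")
  case True
  have "AE x in P. x \<notin> b"
    using True b by (intro AE_not_in) (simp add: null_setsI PX.emeasure_eq_measure sets_P)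
  then have "AE x in distr M borel (Xs 1). x \<notin> b" by (simp only: distr_Xs[OF order_refl])
  then have "AE \<omega> in M. Xs 1 \<omega> \<notin> b"
    by (rule AE_distrD[OF Xs_measurable[OF order_refl]])
  then show ?thesis by eventually_elim simp
next
  case False
  define p where "p = measure P b"
  have p: "0 < p" "p \<le> 1" using False by (auto simp: p_def zero_less_measure_iff)
  define C where "C = {\<omega> \<in> space M. \<forall>j\<ge>2. Xs j \<omega> \<notin> b}"
  have meas: "{\<omega> \<in> space M. Xs j \<omega> \<notin> b} \<in> sets M" if "1 \<le> j" for j
  proof -
    have "{\<omega> \<in> space M. Xs j \<omega> \<notin> b} = Xs j -` (- b) \<inter> space M" by auto
    also have "\<dots> \<in> sets M" using b by (intro measurable_sets[OF Xs_measurable[OF that]]) auto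
    finally show ?thesis .
  qed
  have C: "C \<in> sets M"
  proof -
    have "C = (\<Inter>j\<in>{2..}. {\<omega> \<in> space M. Xs j \<omega> \<notin> b})" by (auto simp: C_def)
    also have "\<dots> \<in> sets M" by (intro sets.countable_INT' image_subsetI meas) auto
    finally show ?thesis .
  qed
  have le: "prob C \<le> (1 - p) ^ n" for n
  proof (cases "n = 0")
    case False
    \<comment> \<open>Independence is given for the pairs, so events on covariates are written as
      preimages of strips. The index set \<open>{2..n+1}\<close> has \<open>n\<close> elements and
      is nonempty here.\<close>
    have "C \<subseteq> (\<Inter>i\<in>{2..n+1}. Zs i -` ((- b) \<times> UNIV) \<inter> space M)"
      using False by (auto simp: C_def)
    then have "prob C \<le> prob (\<Inter>i\<in>{2..n+1}. Zs i -` ((- b) \<times> UNIV) \<inter> space M)"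
    proof (rule finite_measure_mono)
      have "Zs i -` ((- b) \<times> UNIV) \<inter> space M \<in> sets M" if "1 \<le> i" for i
        using b by (intro measurable_sets[OF Zs_measurable[OF that]]) auto
      then show "(\<Inter>i\<in>{2..n+1}. Zs i -` ((- b) \<times> UNIV) \<inter> space M) \<in> sets M"
        using False by (intro sets.finite_INT) auto
    qed
    also have "\<dots> = (\<Prod>i\<in>{2..n+1}. prob (Zs i -` ((- b) \<times> UNIV) \<inter> space M))"
      using False b by (intro indep_varsD[OF indep]) auto
    also have "\<dots> = (\<Prod>i\<in>{2..n+1}. 1 - p)"
    proof (rule prod.cong[OF refl])
      fix i assume "i \<in> {2..n+1}"
      then have i: "1 \<le> i" by simp
      have "prob (Zs i -` ((- b) \<times> UNIV) \<inter> space M) = prob (Xs i -` (- b) \<inter> space M)"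
        by (rule arg_cong[where f=prob]) auto
      also have "\<dots> = measure (distr M borel (Xs i)) (- b)"
        using b Xs_measurable[OF i] by (intro measure_distr[symmetric]) auto
      also have "\<dots> = 1 - p"
        using PX.prob_compl[of b] b unfolding distr_Xs[OF i] p_def by (simp add: Compl_eq_Diff_UNIV sets_P)
      finally show "prob (Zs i -` ((- b) \<times> UNIV) \<inter> space M) = 1 - p" .
    qed
    also have "\<dots> = (1 - p) ^ n" by simp
    finally show ?thesis .
  qed simp
  have "(\<lambda>n. (1 - p) ^ n) \<longlonglongrightarrow> 0" using p by (intro LIMSEQ_realpow_zero) auto
  then have "prob C \<le> 0" using le by (intro LIMSEQ_le_const) auto
  then have "AE \<omega> in M. \<omega> \<notin> C"
    using C by (intro AE_not_in) (simp add: null_setsI emeasure_eq_measure measure_le_0_iff)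
  then show ?thesis using AE_space by eventually_elim (auto simp: C_def)
qed

text \<open>A countable basis needs only one exceptional null set. Outside it every ball around the
  first covariate contains some later covariate \<open>Xs j\<close>, and for
  \<open>n \<ge> j\<close> the nearest neighbour is at least as close as that one.\<close>

lemma XN_tendsto: "AE \<omega> in M. (\<lambda>n. XN n \<omega>) \<longlonglongrightarrow> Xs 1 \<omega>"
proof -
  obtain B :: "'a set set" where B: "countable B" "topological_basis B"
    using ex_countable_basis by blast
  have "AE \<omega> in M. \<forall>b\<in>B. Xs 1 \<omega> \<in> b \<longrightarrow> (\<exists>j\<ge>2. Xs j \<omega> \<in> b)"
    unfolding AE_ball_countable[OF B(1)]
    using topological_basis_open[OF B(2)] by (intro ballI AE_sample_visits_open)
  then show ?thesis
  proof eventually_elim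
    case (elim \<omega>)
    show ?case
    proof (rule metric_LIMSEQ_I)
      fix r :: real assume "0 < r"
      then obtain b where b: "b \<in> B" "Xs 1 \<omega> \<in> b" "b \<subseteq> ball (Xs 1 \<omega>) r"
        using topological_basisE[OF B(2) open_ball, of "Xs 1 \<omega>" "Xs 1 \<omega>" r] by auto
      then obtain j where j: "2 \<le> j" "Xs j \<omega> \<in> b" using elim by blast
      then have d: "dist (Xs 1 \<omega>) (Xs j \<omega>) < r" using b by auto
      have "dist (XN n \<omega>) (Xs 1 \<omega>) < r" if n: "j \<le> n" for n
      proof -
        have "dist (Xs 1 \<omega>) (XN n \<omega>) \<le> dist (Xs 1 \<omega>) (Xs j \<omega>)"
          using n j by (intro nn_index_nearest[of n j 1 "\<lambda>i. Xs i \<omega>"]) auto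
        then show ?thesis using d by (simp add: dist_commute)
      qed
      then show "\<exists>N. \<forall>n\<ge>N. dist (XN n \<omega>) (Xs 1 \<omega>) < r" by blast
    qed
  qed
qed

text \<open>Almost surely the neighbours converge to the first covariate. Wherever \<open>f\<close>
  is constant near it for a given \<open>u\<close>, the labels eventually agree. Dominated
  convergence is applied twice, first in \<open>u\<close> and then in
  \<open>\<omega>\<close>.\<close>

lemma disagree_tendsto_of_locally_constant:
  assumes loc: "AE x in P. AE u in \<Lambda>. eventually (\<lambda>y. f y u = f x u) (nhds x)"
  shows "(\<lambda>n. \<integral>\<omega>. \<integral>u. disagree n \<omega> u \<partial>\<Lambda> \<partial>M) \<longlonglongrightarrow> 0"
proof (rule LIMSEQ_offset[of _ 2])
  have "AE x in distr M borel (Xs 1). AE u in \<Lambda>. eventually (\<lambda>y. f y u = f x u) (nhds x)"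
    using loc by (simp only: distr_Xs[OF order_refl])
  then have loc': "AE \<omega> in M. AE u in \<Lambda>. eventually (\<lambda>y. f y u = f (Xs 1 \<omega>) u) (nhds (Xs 1 \<omega>))"
    by (rule AE_distrD[OF Xs_measurable[OF order_refl]])
  have "(\<lambda>n. \<integral>\<omega>. \<integral>u. disagree (n + 2) \<omega> u \<partial>\<Lambda> \<partial>M) \<longlonglongrightarrow> (\<integral>\<omega>. 0 \<partial>M)"
  proof (rule integral_dominated_convergence[where w="\<lambda>_. 1"])
    show "AE \<omega> in M. (\<lambda>n. \<integral>u. disagree (n + 2) \<omega> u \<partial>\<Lambda>) \<longlonglongrightarrow> 0"
      using loc' XN_tendsto
    proof eventually_elim
      case (elim \<omega>)
      have "(\<lambda>n. \<integral>u. disagree (n + 2) \<omega> u \<partial>\<Lambda>) \<longlonglongrightarrow> (\<integral>u. 0 \<partial>\<Lambda>)"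
      proof (rule integral_dominated_convergence[where w="\<lambda>_. 1"])
        show "AE u in \<Lambda>. (\<lambda>n. disagree (n + 2) \<omega> u) \<longlonglongrightarrow> 0"
          using elim(1)
        proof eventually_elim
          case (elim u)
          from filterlim_iff[THEN iffD1, OF \<open>(\<lambda>n. XN n \<omega>) \<longlonglongrightarrow> Xs 1 \<omega>\<close>, rule_format, OF elim]
          have "eventually (\<lambda>n. disagree n \<omega> u = 0) sequentially"
            by eventually_elim (simp add: disagree_def)
          then have "(\<lambda>n. disagree n \<omega> u) \<longlonglongrightarrow> 0" by (rule tendsto_eventually)
          then show ?case by (rule LIMSEQ_ignore_initial_segment)
        qed
      qed (simp_all add: disagree_section_measurable disagree_bounds del: real_norm_def)
      then show ?case by simp
    qed
    show "(\<lambda>\<omega>. \<integral>u. disagree (n + 2) \<omega> u \<partial>\<Lambda>) \<in> borel_measurable M" for n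
      by (rule disagree_mean_measurable) simp
    show "AE \<omega> in M. norm (\<integral>u. disagree (n + 2) \<omega> u \<partial>\<Lambda>) \<le> 1" for n
      using disagree_mean_bounds by (simp add: abs_of_nonneg)
  qed simp_all
  then show "(\<lambda>n. \<integral>\<omega>. \<integral>u. disagree (n + 2) \<omega> u \<partial>\<Lambda> \<partial>M) \<longlonglongrightarrow> 0" by simp
qed

theorem phat_strongly_consistent:
  fixes kn :: "nat \<Rightarrow> real"
  assumes "summable (\<lambda>n. prob {\<omega> \<in> space M. kn n \<le> max_indegree n (\<lambda>i. Xs i \<omega>)})"
    and "kn \<in> o(\<lambda>n. sqrt (real n / ln (real n)))"
    and "(\<lambda>n. \<integral>\<omega>. \<integral>u. disagree n \<omega> u \<partial>\<Lambda> \<partial>M) \<longlonglongrightarrow> 0"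
  shows "AE \<omega> in M. (\<lambda>n. phat n k l \<omega>) \<longlonglongrightarrow> (\<integral>x. R k x * R l x \<partial>P)"
  using phat_minus_expectation_tendsto[OF assms(1,2), of k l]
proof eventually_elim
  case (elim \<omega>)
  from tendsto_add[OF elim expectation_phat_tendsto[OF assms(3), of k l]] show ?case by simp
qed

end

section \<open>Measurability and local constancy of the threshold function\<close>

lemma level_fun_measurable:
  assumes [measurable]: "\<And>m. m \<in> {1..K} \<Longrightarrow> Q m \<in> borel_measurable borel"
  shows "case_prod (level_fun K Q) \<in> measurable (borel \<Otimes>\<^sub>M borel) (count_space UNIV)"
proof -
  let ?N = "borel \<Otimes>\<^sub>M borel :: ('a \<times> real) measure"
  \<comment> \<open>The function is factored through the finite set of admissible levels. This has
    finitely many possible values, with fibres cut out by threshold events, and \<open>Min\<close>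
    is measurable on a count space whatever its value at the empty set.\<close>
  define T where "T z = {k \<in> {1..K}. snd z < (\<Sum>j=1..k. Q j (fst z))}" for z :: "'a \<times> real"
  have S: "(\<lambda>z :: 'a \<times> real. \<Sum>j=1..k. Q j (fst z)) \<in> borel_measurable ?N" if "k \<in> {1..K}" for k
    using that by (intro borel_measurable_sum measurable_compose[OF measurable_fst assms]) auto
  have "T \<in> measurable ?N (count_space (Pow {1..K}))"
  proof (rule measurable_count_space_eq2[THEN iffD2, OF _ conjI, rule_format])
    fix A assume "A \<in> Pow {1..K}"
    then have T: "T z = A \<longleftrightarrow> (\<forall>k\<in>{1..K}. (snd z < (\<Sum>j=1..k. Q j (fst z))) = (k \<in> A))" for z
      unfolding T_def by blast
    have "T -` {A} \<inter> space ?N = {z \<in> space ?N. T z = A}" by blast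
    also have "\<dots> = {z \<in> space ?N. \<forall>k\<in>{1..K}. (snd z < (\<Sum>j=1..k. Q j (fst z))) = (k \<in> A)}"
      by (simp only: T)
    also have "\<dots> \<in> sets ?N"
    proof (intro sets.sets_Collect_finite_All)
      fix k assume k: "k \<in> {1..K}"
      note [measurable] = S[OF k]
      show "{z \<in> space ?N. (snd z < (\<Sum>j=1..k. Q j (fst z))) = (k \<in> A)} \<in> sets ?N"
      proof -
        have [measurable]: "Measurable.pred ?N (\<lambda>z. snd z < (\<Sum>j=1..k. Q j (fst z)))" by measurable
        show ?thesis by measurable
      qed
    qed simp
    finally show "T -` {A} \<inter> space ?N \<in> sets ?N" .
  qed (auto simp: T_def)
  then have "(\<lambda>z. Min (T z)) \<in> measurable ?N (count_space UNIV)"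
    by (rule measurable_compose) simp
  then show ?thesis by (simp add: T_def level_fun_def case_prod_beta')
qed

text \<open>When \<open>u\<close> differs from every partial sum at \<open>x\<close>, each strict
  comparison of \<open>u\<close> with a partial sum keeps its truth value for points near
  \<open>x\<close>. The set of admissible levels, and with it its minimum, is therefore locally
  unchanged.\<close>

lemma level_fun_locally_constant:
  fixes x :: "'a::t2_space"
  assumes cont: "\<And>m. m \<in> {1..K} \<Longrightarrow> isCont (Q m) x"
    and u: "u \<notin> (\<lambda>k. \<Sum>j=1..k. Q j x) ` {1..K}"
  shows "\<forall>\<^sub>F y in nhds x. level_fun K Q y u = level_fun K Q x u"
proof -
  have "\<forall>\<^sub>F y in nhds x. (u < (\<Sum>j=1..k. Q j y)) = (u < (\<Sum>j=1..k. Q j x))" if k: "k \<in> {1..K}" for k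
  proof -
    have "((\<lambda>y. \<Sum>j=1..k. Q j y) \<longlongrightarrow> (\<Sum>j=1..k. Q j x)) (nhds x)"
      using cont k by (intro tendsto_sum) (auto simp: isCont_def tendsto_at_iff_tendsto_nhds)
    note lim = order_tendstoD[OF this]
    have "(\<Sum>j=1..k. Q j x) \<noteq> u" using u k by blast
    then consider "u < (\<Sum>j=1..k. Q j x)" | "(\<Sum>j=1..k. Q j x) < u" by linarith
    then show ?thesis
    proof cases
      case 1
      from lim(1)[OF this] show ?thesis by eventually_elim (use 1 in simp)
    next
      case 2
      from lim(2)[OF this] show ?thesis by eventually_elim (use 2 in simp)
    qed
  qed
  then have "\<forall>\<^sub>F y in nhds x. \<forall>k\<in>{1..K}. (u < (\<Sum>j=1..k. Q j y)) = (u < (\<Sum>j=1..k. Q j x))"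
    by (intro eventually_ball_finite) auto
  then show ?thesis
  proof eventually_elim
    case (elim y)
    then show ?case unfolding level_fun_def by (intro arg_cong[where f=Min]) auto
  qed
qed

section \<open>Joint laws of two and three independent variables\<close>

context prob_space
begin

lemma distr_pair_eq:
  assumes A [measurable]: "random_variable MA A" and B [measurable]: "random_variable MB B"
    and prod: "\<And>S T. S \<in> sets MA \<Longrightarrow> T \<in> sets MB \<Longrightarrow>
      prob ((A -` S \<inter> space M) \<inter> (B -` T \<inter> space M)) = prob (A -` S \<inter> space M) * prob (B -` T \<inter> space M)"
  shows "distr M (MA \<Otimes>\<^sub>M MB) (\<lambda>\<omega>. (A \<omega>, B \<omega>)) = distr M MA A \<Otimes>\<^sub>M distr M MB B"
proof -
  interpret A: prob_space "distr M MA A" by (rule prob_space_distr) (rule A)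
  interpret B: prob_space "distr M MB B" by (rule prob_space_distr) (rule B)
  show ?thesis
  proof (rule pair_measure_eqI[symmetric])
    fix S T assume "S \<in> sets (distr M MA A)" "T \<in> sets (distr M MB B)"
    then have S [measurable]: "S \<in> sets MA" and T [measurable]: "T \<in> sets MB" by simp_all
    have eq: "(\<lambda>\<omega>. (A \<omega>, B \<omega>)) -` (S \<times> T) \<inter> space M = (A -` S \<inter> space M) \<inter> (B -` T \<inter> space M)" by auto
    show "emeasure (distr M MA A) S * emeasure (distr M MB B) T =
        emeasure (distr M (MA \<Otimes>\<^sub>M MB) (\<lambda>\<omega>. (A \<omega>, B \<omega>))) (S \<times> T)"
      using prod[OF S T] by (simp add: emeasure_distr eq emeasure_eq_measure ennreal_mult[symmetric])
  qed (auto intro: sets_pair_measure_cong A.sigma_finite_measure_axioms B.sigma_finite_measure_axioms)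
qed

text \<open>Pairwise independence gives the laws of two variables. For the triple, the last two
  variables are grouped: \<open>(B, C)\<close> is measurable with respect to the sigma-algebra
  generated by both, which is independent of the events of \<open>A\<close>.\<close>

lemma indep_var3_distr:
  assumes "indep_var3 MA A MB B MC C"
  shows "distr M (MA \<Otimes>\<^sub>M MB) (\<lambda>\<omega>. (A \<omega>, B \<omega>)) = distr M MA A \<Otimes>\<^sub>M distr M MB B"
    and "distr M (MA \<Otimes>\<^sub>M (MB \<Otimes>\<^sub>M MC)) (\<lambda>\<omega>. (A \<omega>, B \<omega>, C \<omega>)) =
      distr M MA A \<Otimes>\<^sub>M (distr M MB B \<Otimes>\<^sub>M distr M MC C)"
proof -
  define E where "E i = (if i = 0 then {A -` S \<inter> space M | S. S \<in> sets MA}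
       else if i = 1 then {B -` S \<inter> space M | S. S \<in> sets MB}
       else {C -` S \<inter> space M | S. S \<in> sets MC})" for i :: nat
  have rv: "random_variable MA A" "random_variable MB B" "random_variable MC C"
    and ind: "indep_sets E {0, 1, 2}"
    using assms unfolding indep_var3_def E_def[abs_def] by blast+
  have pair: "prob (a \<inter> b) = prob a * prob b" if "a \<in> E i" "b \<in> E j" "i \<noteq> j" "{i, j} \<subseteq> {0, 1, 2}" for a b i j
    using indep_setsD[OF ind that(4), of "\<lambda>l. if l = i then a else b"] that by (auto simp: Int_commute)
  have "prob ((A -` S \<inter> space M) \<inter> (B -` T \<inter> space M)) = prob (A -` S \<inter> space M) * prob (B -` T \<inter> space M)"
    if "S \<in> sets MA" "T \<in> sets MB" for S T
    by (rule pair[of _ 0 _ 1]) (use that in \<open>auto simp: E_def\<close>)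
  then show "distr M (MA \<Otimes>\<^sub>M MB) (\<lambda>\<omega>. (A \<omega>, B \<omega>)) = distr M MA A \<Otimes>\<^sub>M distr M MB B"
    by (intro distr_pair_eq rv)
  have "prob ((B -` S \<inter> space M) \<inter> (C -` T \<inter> space M)) = prob (B -` S \<inter> space M) * prob (C -` T \<inter> space M)"
    if "S \<in> sets MB" "T \<in> sets MC" for S T
    by (rule pair[of _ 1 _ 2]) (use that in \<open>auto simp: E_def\<close>)
  then have BC: "distr M (MB \<Otimes>\<^sub>M MC) (\<lambda>\<omega>. (B \<omega>, C \<omega>)) = distr M MB B \<Otimes>\<^sub>M distr M MC C"
    by (intro distr_pair_eq rv)
  have preimage_Int: "Int_stable {Z -` S \<inter> space M | S. S \<in> sets N}" for Z and N :: "'z measure"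
  proof (rule Int_stableI)
    fix a b assume "a \<in> {Z -` S \<inter> space M | S. S \<in> sets N}" "b \<in> {Z -` S \<inter> space M | S. S \<in> sets N}"
    then obtain S T where "S \<in> sets N" "a = Z -` S \<inter> space M" "T \<in> sets N" "b = Z -` T \<inter> space M" by blast
    then show "a \<inter> b \<in> {Z -` S \<inter> space M | S. S \<in> sets N}" by (intro CollectI exI[of _ "S \<inter> T"]) auto
  qed
  have stable: "Int_stable (E i)" for i unfolding E_def by (simp add: preimage_Int)
  \<comment> \<open>The families with index 1 and 2 are merged into one. Each family is closed under
    intersection, so independence passes to the generated sigma-algebras.\<close>
  have sets_indep: "indep_sets (\<lambda>j. sigma_sets (space M) (\<Union>i\<in>case_bool {0} {1, 2} j. E i)) UNIV"
  proof (rule indep_sets_collect_sigma)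
    have "(\<Union>j. case_bool {0} {1, 2} j) = {0, 1, 2 :: nat}" by (auto simp: UNIV_bool)
    then show "indep_sets E (\<Union>j. case_bool {0} {1, 2} j)" using ind by simp
    show "disjoint_family (case_bool {0} {1, 2 :: nat})"
      by (auto simp: disjoint_family_on_def split: bool.splits)
  qed (rule stable)
  have sigma_indep: "prob (a \<inter> b) = prob a * prob b"
    if "a \<in> sigma_sets (space M) (E 0)" "b \<in> sigma_sets (space M) (E 1 \<union> E 2)" for a b
  proof -
    have "prob (\<Inter>j\<in>UNIV. case_bool a b j) = (\<Prod>j\<in>UNIV. prob (case_bool a b j))"
      by (rule indep_setsD[OF sets_indep]) (use that in \<open>auto split: bool.splits\<close>)
    then show ?thesis by (simp add: UNIV_bool Int_commute mult.commute)
  qed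
  let ?S = "sigma (space M) (E 1 \<union> E 2)"
  have E12: "E 1 \<union> E 2 \<subseteq> Pow (space M)" by (auto simp: E_def)
  have B: "B \<in> measurable ?S MB"
    by (rule measurableI) (use E12 measurable_space[OF rv(2)] in \<open>auto simp: E_def intro!: sigma_sets.Basic\<close>)
  have C: "C \<in> measurable ?S MC"
    by (rule measurableI) (use E12 measurable_space[OF rv(3)] in \<open>auto simp: E_def intro!: sigma_sets.Basic\<close>)
  have "distr M (MA \<Otimes>\<^sub>M (MB \<Otimes>\<^sub>M MC)) (\<lambda>\<omega>. (A \<omega>, B \<omega>, C \<omega>)) =
      distr M MA A \<Otimes>\<^sub>M distr M (MB \<Otimes>\<^sub>M MC) (\<lambda>\<omega>. (B \<omega>, C \<omega>))"
  proof (rule distr_pair_eq)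
    fix S T assume S: "S \<in> sets MA" and T: "T \<in> sets (MB \<Otimes>\<^sub>M MC)"
    show "prob ((A -` S \<inter> space M) \<inter> ((\<lambda>\<omega>. (B \<omega>, C \<omega>)) -` T \<inter> space M)) =
        prob (A -` S \<inter> space M) * prob ((\<lambda>\<omega>. (B \<omega>, C \<omega>)) -` T \<inter> space M)"
    proof (rule sigma_indep)
      show "A -` S \<inter> space M \<in> sigma_sets (space M) (E 0)"
        using S by (intro sigma_sets.Basic) (auto simp: E_def)
      show "(\<lambda>\<omega>. (B \<omega>, C \<omega>)) -` T \<inter> space M \<in> sigma_sets (space M) (E 1 \<union> E 2)"
        using measurable_sets[OF measurable_Pair[OF B C] T] E12 by simp
    qed
  qed (intro rv measurable_Pair)+
  then show "distr M (MA \<Otimes>\<^sub>M (MB \<Otimes>\<^sub>M MC)) (\<lambda>\<omega>. (A \<omega>, B \<omega>, C \<omega>)) =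
      distr M MA A \<Otimes>\<^sub>M (distr M MB B \<Otimes>\<^sub>M distr M MC C)"
    unfolding BC .
qed

end

section \<open>Label probabilities as integrals over the covariate law\<close>

context nn_sample
begin

lemma prob_label:
  assumes [measurable]: "X \<in> borel_measurable M" "U \<in> borel_measurable M"
    and XU: "distr M (borel \<Otimes>\<^sub>M borel) (\<lambda>\<omega>. (X \<omega>, U \<omega>)) = P \<Otimes>\<^sub>M \<Lambda>"
  shows "prob {\<omega> \<in> space M. f (X \<omega>) (U \<omega>) = i} = (\<integral>x. R i x \<partial>P)"
proof -
  have m: "(\<lambda>z. of_bool (f (fst z) (snd z) = i) :: real) \<in> borel_measurable (borel \<Otimes>\<^sub>M borel)" by measurable
  have int: "integrable (P \<Otimes>\<^sub>M \<Lambda>) (\<lambda>z. of_bool (f (fst z) (snd z) = i) :: real)"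
    by (rule integrable_abs_le_const[OF PXU.prob_space_axioms, where C=1])
      (use m measurable_cong_sets[OF sets_P\<Lambda> refl] in auto)
  have "prob {\<omega> \<in> space M. f (X \<omega>) (U \<omega>) = i} = (\<integral>\<omega>. of_bool (f (X \<omega>) (U \<omega>) = i) \<partial>M)"
    by (subst Bochner_Integration.integral_cong[OF refl, where g="indicator {\<omega> \<in> space M. f (X \<omega>) (U \<omega>) = i}"])
      (auto simp: indicator_def Int_absorb1 Int_absorb2 subset_eq)
  also have "\<dots> = (\<integral>z. of_bool (f (fst z) (snd z) = i) \<partial>distr M (borel \<Otimes>\<^sub>M borel) (\<lambda>\<omega>. (X \<omega>, U \<omega>)))"
    using m by (subst integral_distr) auto
  also have "\<dots> = (\<integral>x. R i x \<partial>P)"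
    using PXU.integral_fst'[OF int] by (simp add: XU R_def)
  finally show ?thesis .
qed

text \<open>Given \<open>X = x\<close>, the two labels come from independent randomisations, so the
  inner integral factors into \<open>R i x * R j x\<close>. This identifies the joint probability
  with the limit of the estimates.\<close>

lemma prob_label_pair:
  assumes [measurable]: "X \<in> borel_measurable M" "U \<in> borel_measurable M" "U' \<in> borel_measurable M"
    and XUU: "distr M (borel \<Otimes>\<^sub>M (borel \<Otimes>\<^sub>M borel)) (\<lambda>\<omega>. (X \<omega>, U \<omega>, U' \<omega>)) = P \<Otimes>\<^sub>M (\<Lambda> \<Otimes>\<^sub>M \<Lambda>)"
  shows "prob {\<omega> \<in> space M. f (X \<omega>) (U \<omega>) = i \<and> f (X \<omega>) (U' \<omega>) = j} = (\<integral>x. R i x * R j x \<partial>P)"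
proof -
  interpret UU: pair_prob_space \<Lambda> \<Lambda> ..
  interpret XUU: pair_prob_space P "\<Lambda> \<Otimes>\<^sub>M \<Lambda>" ..
  let ?g = "\<lambda>z. of_bool (f (fst z) (fst (snd z)) = i) * of_bool (f (fst z) (snd (snd z)) = j) :: real"
  let ?B = "borel \<Otimes>\<^sub>M (borel \<Otimes>\<^sub>M borel) :: ('a \<times> real \<times> real) measure"
  have m: "?g \<in> borel_measurable ?B" by measurable
  have sets: "sets (P \<Otimes>\<^sub>M (\<Lambda> \<Otimes>\<^sub>M \<Lambda>)) = sets ?B"
    by (intro sets_pair_measure_cong sets_P sets_\<Lambda>)
  have int: "integrable (P \<Otimes>\<^sub>M (\<Lambda> \<Otimes>\<^sub>M \<Lambda>)) ?g"
    by (rule integrable_abs_le_const[OF XUU.prob_space_axioms, where C=1])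
      (use m measurable_cong_sets[OF sets refl] in auto)
  have sec: "(\<integral>w. of_bool (f x (fst w) = i) * of_bool (f x (snd w) = j) \<partial>(\<Lambda> \<Otimes>\<^sub>M \<Lambda>)) = R i x * R j x" for x
  proof -
    have "(\<lambda>w. of_bool (f x (fst w) = i) * of_bool (f x (snd w) = j) :: real) \<in> borel_measurable (borel \<Otimes>\<^sub>M borel)"
      by measurable
    then have "integrable (\<Lambda> \<Otimes>\<^sub>M \<Lambda>) (\<lambda>w. of_bool (f x (fst w) = i) * of_bool (f x (snd w) = j) :: real)"
      by (intro integrable_abs_le_const[OF UU.prob_space_axioms, where C=1])
        (use measurable_cong_sets[OF sets_pair_measure_cong[OF sets_\<Lambda> sets_\<Lambda>] refl] in auto)
    from UU.integral_fst'[OF this] show ?thesis by (simp add: R_def)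
  qed
  have "prob {\<omega> \<in> space M. f (X \<omega>) (U \<omega>) = i \<and> f (X \<omega>) (U' \<omega>) = j} = (\<integral>\<omega>. ?g (X \<omega>, U \<omega>, U' \<omega>) \<partial>M)"
    by (subst Bochner_Integration.integral_cong[OF refl,
          where g="indicator {\<omega> \<in> space M. f (X \<omega>) (U \<omega>) = i \<and> f (X \<omega>) (U' \<omega>) = j}"])
      (auto simp: indicator_def Int_absorb1 Int_absorb2 subset_eq)
  also have "\<dots> = (\<integral>z. ?g z \<partial>distr M ?B (\<lambda>\<omega>. (X \<omega>, U \<omega>, U' \<omega>)))"
    using m by (subst integral_distr) auto
  also have "\<dots> = (\<integral>x. R i x * R j x \<partial>P)"
    using XUU.integral_fst'[OF int] by (simp add: XUU sec)
  finally show ?thesis .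
qed

text \<open>In general only an inequality, because an abstract \<open>f\<close> may take values
  outside \<open>{1..K}\<close>.\<close>

lemma sum_R_le_1: "(\<Sum>l=1..K. R l x) \<le> 1"
proof -
  have "(\<Sum>l=1..K. R l x) = (\<integral>u. (\<Sum>l=1..K. of_bool (f x u = l)) \<partial>\<Lambda>)"
    unfolding R_def by (intro Bochner_Integration.integral_sum[symmetric] section_integrable)
  also have "\<dots> \<le> 1"
  proof (rule PU.integral_le_const)
    show "integrable \<Lambda> (\<lambda>u. \<Sum>l=1..K. of_bool (f x u = l) :: real)"
      by (intro Bochner_Integration.integrable_sum section_integrable)
    have "(\<Sum>l=1..K. of_bool (f x u = l) :: real) = (\<Sum>l=1..K. if f x u = l then 1 else 0)" for u
      by (intro sum.cong) auto
    then have "(\<Sum>l=1..K. of_bool (f x u = l) :: real) \<le> 1" for u by simp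
    then show "AE u in \<Lambda>. (\<Sum>l=1..K. of_bool (f x u = l) :: real) \<le> 1" by simp
  qed
  finally show ?thesis .
qed

text \<open>If the means of the \<open>R l\<close> add up to 1, the nonnegative defect
  \<open>1 - (\<Sum>l=1..K. R l x)\<close> has integral 0 and vanishes almost everywhere.
  Multiplying by \<open>R k\<close> then gives the marginal.\<close>

lemma sum_integral_R_mult:
  assumes "(\<Sum>l=1..K. \<integral>x. R l x \<partial>P) = 1"
  shows "(\<Sum>l=1..K. \<integral>x. R k x * R l x \<partial>P) = (\<integral>x. R k x \<partial>P)"
proof -
  have RP: "R m \<in> borel_measurable P" for m
    using R_measurable[of m] measurable_cong_sets[OF sets_P refl] by blast
  have int: "integrable P (R m)" for m
    by (rule integrable_abs_le_const[OF P RP R_abs])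
  have int2: "integrable P (\<lambda>x. R k x * R l x)" for l
    by (rule integrable_abs_le_const[OF P, where C=1]) (intro borel_measurable_times RP abs_mult_le_left R_abs)+
  have "(\<integral>x. 1 - (\<Sum>l=1..K. R l x) \<partial>P) = 0"
    using assms int by (simp add: Bochner_Integration.integral_sum PX.prob_space[unfolded space_P])
  then have "AE x in P. 1 - (\<Sum>l=1..K. R l x) = 0"
    using sum_R_le_1 int by (subst (asm) integral_nonneg_eq_0_iff_AE) auto
  then have ae: "AE x in P. R k x * (\<Sum>l=1..K. R l x) = R k x" by eventually_elim simp
  have "(\<Sum>l=1..K. \<integral>x. R k x * R l x \<partial>P) = (\<integral>x. R k x * (\<Sum>l=1..K. R l x) \<partial>P)"
    unfolding sum_distrib_left by (intro Bochner_Integration.integral_sum[symmetric] int2)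
  also have "\<dots> = (\<integral>x. R k x \<partial>P)"
    using ae by (intro integral_cong_AE) (auto intro!: borel_measurable_times borel_measurable_sum RP)
  finally show ?thesis .
qed

end

theorem theorem3:
  fixes M :: "'w measure"
    and X :: "'w \<Rightarrow> 'a::{metric_space, second_countable_topology}"
    and U U' :: "'w \<Rightarrow> real"
    and Y Y' :: "'w \<Rightarrow> nat"
    and K :: nat
    and Q :: "nat \<Rightarrow> 'a \<Rightarrow> real"
    and Xs :: "nat \<Rightarrow> 'w \<Rightarrow> 'a"
    and Us :: "nat \<Rightarrow> 'w \<Rightarrow> real"
    and Ys :: "nat \<Rightarrow> 'w \<Rightarrow> nat"
    and k :: "nat \<Rightarrow> real"
  assumes prob: "prob_space M"
    and K: "K \<ge> 2"
    and Y_levels: "Y \<in> measurable M (count_space {1..K})"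
    and Y_pos: "\<And>m. m \<in> {1..K} \<Longrightarrow> \<P>(\<omega> in M. Y \<omega> = m) > 0"
    and Q: "\<And>m. m \<in> {1..K} \<Longrightarrow> cond_prob_version M X Y m (Q m)"
    and indep: "prob_space.indep_var3 M borel X borel U borel U'"
    and U: "distr M borel U = uniform_measure lborel {0<..<1}"
    and U': "distr M borel U' = uniform_measure lborel {0<..<1}"
    and Y: "AE \<omega> in M. Y \<omega> = level_fun K Q (X \<omega>) (U \<omega>)"
    and Y': "\<And>\<omega>. Y' \<omega> = level_fun K Q (X \<omega>) (U' \<omega>)"
    and sample_indep: "prob_space.indep_vars M (\<lambda>_. borel \<Otimes>\<^sub>M borel) (\<lambda>i \<omega>. (Xs i \<omega>, Us i \<omega>)) {1..}"
    and sample_distr: "\<And>i. i \<ge> 1 \<Longrightarrow>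
          distr M (borel \<Otimes>\<^sub>M borel) (\<lambda>\<omega>. (Xs i \<omega>, Us i \<omega>)) =
          distr M (borel \<Otimes>\<^sub>M borel) (\<lambda>\<omega>. (X \<omega>, U \<omega>))"
    and Ys: "\<And>i \<omega>. i \<ge> 1 \<Longrightarrow> Ys i \<omega> = level_fun K Q (Xs i \<omega>) (Us i \<omega>)"
    and dist_cont: "continuous_on UNIV (cdf (distr M borel (\<lambda>\<omega>. dist (Xs 1 \<omega>) (Xs 2 \<omega>))))"
    and a_or_b:
      "(AE u in lborel. u \<in> {0<..<1} \<longrightarrow>
          tendsto_in_prob M
            (\<lambda>n \<omega>. real (level_fun K Q (Xs (nn_index n (\<lambda>i. Xs i \<omega>) 1) \<omega>) u))
            (\<lambda>\<omega>. real (level_fun K Q (Xs 1 \<omega>) u)))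
       \<or> (\<forall>m\<in>{1..K}. AE x in distr M borel X. isCont (Q m) x)"
    and k_summable:
      "(\<lambda>n. \<P>(\<omega> in M. real (max_indegree n (\<lambda>i. Xs i \<omega>)) \<ge> k n)) summable_on {1..}"
    and k_prob:
      "(\<lambda>n. k n * \<P>(\<omega> in M. real (max_indegree n (\<lambda>i. Xs i \<omega>)) \<ge> k n)) \<longlonglongrightarrow> 0"
    and k_small: "k \<in> o(\<lambda>n. sqrt (real n / ln (real n)))"
  shows "AE \<omega> in M. (\<lambda>n. psi_hat K n (\<lambda>i. Ys i \<omega>) (nn_index n (\<lambda>i. Xs i \<omega>)))
           \<longlonglongrightarrow> psi M K Y Y'"
proof -
  interpret prob_space M by (rule prob)
  define P where "P = distr M borel X"
  define \<Lambda> :: "real measure" where "\<Lambda> = uniform_measure lborel {0<..<1}"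
  define f where "f = level_fun K Q"
  note indep3 = indep_var3_distr[OF indep]
  have rv [measurable]: "X \<in> borel_measurable M" "U \<in> borel_measurable M" "U' \<in> borel_measurable M"
    using indep by (auto simp: indep_var3_def)
  have \<Lambda>_prob: "prob_space \<Lambda>" using U rv by (metis \<Lambda>_def prob_space_distr)
  have sets_\<Lambda>: "sets \<Lambda> = sets borel" by (simp add: \<Lambda>_def)
  have XUU: "distr M (borel \<Otimes>\<^sub>M (borel \<Otimes>\<^sub>M borel)) (\<lambda>\<omega>. (X \<omega>, U \<omega>, U' \<omega>)) = P \<Otimes>\<^sub>M (\<Lambda> \<Otimes>\<^sub>M \<Lambda>)"
    unfolding indep3(2) U U' by (simp add: P_def \<Lambda>_def)
  have XU: "distr M (borel \<Otimes>\<^sub>M borel) (\<lambda>\<omega>. (X \<omega>, U \<omega>)) = P \<Otimes>\<^sub>M \<Lambda>"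
    unfolding indep3(1) U by (simp add: P_def \<Lambda>_def)
  have f: "case_prod f \<in> measurable (borel \<Otimes>\<^sub>M borel) (count_space UNIV)"
    unfolding f_def using Q by (intro level_fun_measurable) (auto simp: cond_prob_version_def)
  \<comment> \<open>Each sampled pair has the law of \<open>(X, U)\<close>, which is a product by
    independence, so the abstract setting applies to the threshold function.\<close>
  interpret nn_sample M Xs Us P \<Lambda> f
  proof (rule nn_sample.intro[OF prob nn_sample_axioms.intro])
    show "prob_space P" unfolding P_def by (rule prob_space_distr) (rule rv)
    show "sets P = sets borel" by (simp add: P_def)
    show "distr M (borel \<Otimes>\<^sub>M borel) (\<lambda>\<omega>. (Xs i \<omega>, Us i \<omega>)) = P \<Otimes>\<^sub>M \<Lambda>" if "1 \<le> i" for i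
      unfolding sample_distr[OF that] by (rule XU)
  qed (fact \<Lambda>_prob sets_\<Lambda> f sample_indep)+
  have disagree_lim: "(\<lambda>n. \<integral>\<omega>. \<integral>u. disagree n \<omega> u \<partial>\<Lambda> \<partial>M) \<longlonglongrightarrow> 0"
    using a_or_b
  proof
    assume "AE u in lborel. u \<in> {0<..<1} \<longrightarrow> tendsto_in_prob M
            (\<lambda>n \<omega>. real (level_fun K Q (Xs (nn_index n (\<lambda>i. Xs i \<omega>) 1) \<omega>) u))
            (\<lambda>\<omega>. real (level_fun K Q (Xs 1 \<omega>) u))"
    then have "AE u in \<Lambda>. tendsto_in_prob M (\<lambda>n \<omega>. real (f (XN n \<omega>) u)) (\<lambda>\<omega>. real (f (Xs 1 \<omega>) u))"
      unfolding \<Lambda>_def f_def by (rule AE_uniform_measureI[rotated]) simp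
    then have "AE u in \<Lambda>. (\<lambda>n. prob {\<omega> \<in> space M. f (XN n \<omega>) u \<noteq> f (Xs 1 \<omega>) u}) \<longlonglongrightarrow> 0"
    proof eventually_elim
      case (elim u)
      \<comment> \<open>Distinct naturals are at distance at least 1, so the tolerance 1/2 turns
        convergence in probability into vanishing probability of disagreement.\<close>
      have far: "(1 / 2 < dist (real a) (real b)) = (a \<noteq> b)" for a b :: nat
        by (auto simp: dist_real_def abs_if)
      from elim have "(\<lambda>n. prob {\<omega> \<in> space M. 1 / 2 < dist (real (f (XN n \<omega>) u)) (real (f (Xs 1 \<omega>) u))}) \<longlonglongrightarrow> 0"
        unfolding tendsto_in_prob_def by (elim allE[of _ "1 / 2"] impE) simp_all
      then show ?case unfolding far .
    qed
    then show ?thesis by (rule disagree_tendsto_of_in_prob)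
  next
    assume "\<forall>m\<in>{1..K}. AE x in distr M borel X. isCont (Q m) x"
    then have "AE x in P. \<forall>m\<in>{1..K}. isCont (Q m) x"
      unfolding P_def by (intro AE_finite_allI) auto
    then have "AE x in P. AE u in \<Lambda>. \<forall>\<^sub>F y in nhds x. f y u = f x u"
    proof eventually_elim
      case (elim x)
      let ?S = "(\<lambda>k. \<Sum>j=1..k. Q j x) ` {1..K}"
      \<comment> \<open>At a continuity point only the finitely many partial sums are exceptional
        values of \<open>u\<close>, and a finite set is a Lebesgue null set.\<close>
      have "AE u in lborel. u \<notin> ?S" by (intro AE_not_in finite_imp_null_set_lborel) simp
      then have "AE u in lborel. u \<in> {0<..<1} \<longrightarrow> u \<notin> ?S" by eventually_elim simp
      then have "AE u in \<Lambda>. u \<notin> ?S" unfolding \<Lambda>_def by (rule AE_uniform_measureI[rotated]) simp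
      then show ?case unfolding f_def
        by eventually_elim (rule level_fun_locally_constant, use elim in auto)
    qed
    then show ?thesis by (rule disagree_tendsto_of_locally_constant)
  qed
  have summ: "summable (\<lambda>n. prob {\<omega> \<in> space M. k n \<le> real (max_indegree n (\<lambda>i. Xs i \<omega>))})"
  proof (rule summable_on_imp_summable)
    \<comment> \<open>The hypothesis sums over positive indices; the single term at 0 is added to
      obtain a series over all naturals.\<close>
    have "{0} \<union> {1..} = (UNIV :: nat set)" by auto
    with summable_on_Un_disjoint[OF summable_on_finite[of "{0}"] k_summable]
    show "(\<lambda>n. prob {\<omega> \<in> space M. k n \<le> real (max_indegree n (\<lambda>i. Xs i \<omega>))}) summable_on UNIV" by simp
  qed
  define p where "p i = (\<integral>x. R i x \<partial>P)" for i
  define pp where "pp i j = (\<integral>x. R i x * R j x \<partial>P)" for i j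
  have Y_event: "{\<omega> \<in> space M. Y \<omega> = i} \<in> events" for i
  proof (cases "i \<in> {1..K}")
    case True
    have "{\<omega> \<in> space M. Y \<omega> = i} = Y -` {i} \<inter> space M" by auto
    then show ?thesis using measurable_sets[OF Y_levels, of "{i}"] True by simp
  next
    case False
    then have "{\<omega> \<in> space M. Y \<omega> = i} = {}" using measurable_space[OF Y_levels] by auto
    then show ?thesis by (simp only: sets.empty_sets)
  qed
  have prob_Y: "prob {\<omega> \<in> space M. Y \<omega> = i} = p i" for i
  proof -
    have "prob {\<omega> \<in> space M. Y \<omega> = i} = prob {\<omega> \<in> space M. f (X \<omega>) (U \<omega>) = i}"
      \<comment> \<open>\<open>Y\<close> agrees with the threshold function only almost surely, so
        the two events are compared up to a null set.\<close>
      by (rule finite_measure_eq_AE) (use Y Y_event in \<open>auto simp: f_def[symmetric]\<close>)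
    then show ?thesis using prob_label[OF rv(1,2) XU] by (simp add: p_def)
  qed
  have prob_YY': "prob {\<omega> \<in> space M. Y \<omega> = i \<and> Y' \<omega> = j} = pp i j" for i j
  proof -
    have "{\<omega> \<in> space M. Y \<omega> = i \<and> f (X \<omega>) (U' \<omega>) = j} =
        {\<omega> \<in> space M. Y \<omega> = i} \<inter> {\<omega> \<in> space M. f (X \<omega>) (U' \<omega>) = j}" by auto
    also have "\<dots> \<in> events" by (intro sets.Int Y_event) measurable
    finally have ev: "{\<omega> \<in> space M. Y \<omega> = i \<and> f (X \<omega>) (U' \<omega>) = j} \<in> events" .
    have "prob {\<omega> \<in> space M. Y \<omega> = i \<and> Y' \<omega> = j} = prob {\<omega> \<in> space M. f (X \<omega>) (U \<omega>) = i \<and> f (X \<omega>) (U' \<omega>) = j}"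
      by (rule finite_measure_eq_AE) (use Y ev in \<open>auto simp: Y' f_def[symmetric]\<close>)
    then show ?thesis using prob_label_pair[OF rv XUU] by (simp add: pp_def)
  qed
  \<comment> \<open>The levels of \<open>Y\<close> exhaust \<open>{1..K}\<close>, so the
    \<open>p i\<close> sum to 1; this is what makes \<open>p\<close> the marginal of
    \<open>pp\<close>.\<close>
  have "(\<Sum>i=1..K. p i) = prob (\<Union>i\<in>{1..K}. {\<omega> \<in> space M. Y \<omega> = i})"
    unfolding prob_Y[symmetric] using Y_event
    by (intro finite_measure_finite_Union[symmetric]) (auto simp: disjoint_family_on_def)
  also have "(\<Union>i\<in>{1..K}. {\<omega> \<in> space M. Y \<omega> = i}) = space M"
    using measurable_space[OF Y_levels] by auto
  finally have sum_p: "(\<Sum>i=1..K. p i) = 1" by (simp add: prob_space)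
  have sum_pp: "(\<Sum>j=1..K. pp i j) = p i" for i
    using sum_integral_R_mult[of K i] sum_p by (simp add: p_def pp_def)
  \<comment> \<open>By symmetry of \<open>pp\<close> the column sums agree with the row sums, so
    \<open>q_hat\<close> has the same limit as \<open>p_hat\<close>.\<close>
  have sum_pp': "(\<Sum>i=1..K. pp i j) = p j" for j
    using sum_pp[of j] by (simp add: pp_def mult.commute)
  have p_pos: "0 < p i" if "i \<in> {1..K}" for i using Y_pos[OF that] by (simp only: prob_Y)
  have "AE \<omega> in M. \<forall>i j. (\<lambda>n. phat n i j \<omega>) \<longlonglongrightarrow> pp i j"
    unfolding AE_all_countable pp_def by (intro allI phat_strongly_consistent[OF summ k_small disagree_lim])
  then show ?thesis
  proof eventually_elim
    case (elim \<omega>)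
    let ?p2 = "\<lambda>n. p2_hat n (\<lambda>i. Ys i \<omega>) (nn n \<omega>)"
    have p2: "(\<lambda>n. ?p2 n i j) \<longlonglongrightarrow> pp i j" for i j
    proof (rule Lim_transform_eventually[OF elim[rule_format]])
      show "\<forall>\<^sub>F n in sequentially. phat n i j \<omega> = ?p2 n i j"
        using eventually_ge_at_top[of 2]
      proof eventually_elim
        case (elim n)
        \<comment> \<open>The labels \<open>Ys\<close> are specified from index 1 on, so the
          neighbour index must be seen to lie in that range.\<close>
        have "1 \<le> nn n \<omega> i" for i using nn_index_mem[OF elim, of "\<lambda>i. Xs i \<omega>" i] by simp
        then show ?case unfolding phat_def p2_hat_def
          by (intro arg_cong2[where f="(*)"] refl sum.cong) (simp add: Ys f_def)
      qed
    qed
    have "(\<lambda>n. \<Sum>j=1..K. ?p2 n i j) \<longlonglongrightarrow> (\<Sum>j=1..K. pp i j)" for i by (intro tendsto_sum p2)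
    then have ph: "(\<lambda>n. p_hat K n (\<lambda>i. Ys i \<omega>) (nn n \<omega>) i) \<longlonglongrightarrow> p i" for i
      unfolding p_hat_def sum_pp .
    have "(\<lambda>n. \<Sum>i=1..K. ?p2 n i j) \<longlonglongrightarrow> (\<Sum>i=1..K. pp i j)" for j by (intro tendsto_sum p2)
    then have qh: "(\<lambda>n. q_hat K n (\<lambda>i. Ys i \<omega>) (nn n \<omega>) j) \<longlonglongrightarrow> p j" for j
      unfolding q_hat_def sum_pp' .
    \<comment> \<open>All denominators have positive limits, so every summand is continuous at the
      limit and the convention for zero denominators affects at most finitely many
      \<open>n\<close>.\<close>
    have nz: "p i * p j \<noteq> 0" if "i \<in> {1..K}" "j \<in> {1..K}" for i j
      using p_pos[OF that(1)] p_pos[OF that(2)] by simp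
    show ?case unfolding psi_hat_def psi_def prob_Y prob_YY'
      by (intro tendsto_mult tendsto_const tendsto_sum tendsto_divide tendsto_power tendsto_diff p2 ph qh nz)
  qed
qed

end
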